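(* Let $k \ge 2$ be an integer and let $\Phi$ be a Fuchsian group which is free and freely generated by $\{g_1, \dots, g_k\}$. Let $z$ be any point in $\mathbb{H}^2$ and denote by $d_i = d(z, g_i z)$ the hyperbolic distance between $z$ and $g_i z$. Then $$\sum_{i=1}^k \arccos\left(\tanh\left(\frac{d_i}{2}\right)\right) \le \frac{\pi}{2}.$$ In particular, there exists an $i \in \{1, \dots, k\}$ such that $$d_i \ge \log\left(\frac{1+\cos\frac{\pi}{2k}}{1-\cos\frac{\pi}{2k}}\right).$$ Moreover, when $k=2$, the upper bound $\frac{\pi}{2}$ is realized by the group $\Phi = \Gamma(2) = \left\langle \begin{pmatrix} 1 & 2 \\ 0 & 1 \end{pmatrix}, \begin{pmatrix} 1 & 0 \\ 2 & 1 \end{pmatrix} \right\rangle$ with $g_1, g_2$ the two displayed generators and $z = \sqrt{-1}$; that is, equality holds in the first inequality in this case.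
   Context: $\mathbb{H}^2$ is the hyperbolic plane with its metric of constant curvature $-1$, with distance function $d$; its group of orientation-preserving isometries is identified with $PSL_2(\mathbb{R})$ acting by Möbius transformations on the upper half-plane. A Fuchsian group is a discrete subgroup of $PSL_2(\mathbb{R})$. Matrices are regarded as elements of $PSL_2(\mathbb{R})$. No finite-area assumption is made on $\mathbb{H}^2/\Phi$. *)

theory Defs
  imports
    "HOL-Analysis.Analysis"
    "HOL-Algebra.Coset"
    "HOL-Algebra.Generated_Groups"
begin

section \<open>Quotient topologies\<close>

definition quotient_topology :: "'a topology \<Rightarrow> ('a \<Rightarrow> 'b) \<Rightarrow> 'b topology" where
  "quotient_topology X f =
     topology (\<lambda>U. U \<subseteq> f ` topspace X \<and> openin X {x \<in> topspace X. f x \<in> U})"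

lemma openin_quotient_topology:
  "openin (quotient_topology X f) U \<longleftrightarrow>
     U \<subseteq> f ` topspace X \<and> openin X {x \<in> topspace X. f x \<in> U}"
proof -
  have "istopology (\<lambda>U. U \<subseteq> f ` topspace X \<and> openin X {x \<in> topspace X. f x \<in> U})"
    unfolding istopology_def
  proof (intro conjI allI impI)
    fix S T
    assume S: "S \<subseteq> f ` topspace X \<and> openin X {x \<in> topspace X. f x \<in> S}"
      and T: "T \<subseteq> f ` topspace X \<and> openin X {x \<in> topspace X. f x \<in> T}"
    then show "S \<inter> T \<subseteq> f ` topspace X" by blast
    have "{x \<in> topspace X. f x \<in> S \<inter> T} =
        {x \<in> topspace X. f x \<in> S} \<inter> {x \<in> topspace X. f x \<in> T}" by blast
    then show "openin X {x \<in> topspace X. f x \<in> S \<inter> T}"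
      using openin_Int[OF conjunct2[OF S] conjunct2[OF T]] by (simp only:)
  next
    fix K
    assume K: "\<forall>S\<in>K. S \<subseteq> f ` topspace X \<and> openin X {x \<in> topspace X. f x \<in> S}"
    then show "\<Union> K \<subseteq> f ` topspace X" by blast
    have "{x \<in> topspace X. f x \<in> \<Union> K} = (\<Union>S\<in>K. {x \<in> topspace X. f x \<in> S})" by blast
    moreover have "openin X (\<Union>S\<in>K. {x \<in> topspace X. f x \<in> S})"
      using K by (intro openin_Union) blast
    ultimately show "openin X {x \<in> topspace X. f x \<in> \<Union> K}" by (simp only:)
  qed
  then show ?thesis
    unfolding quotient_topology_def by (simp add: topology_inverse')
qed

lemma topspace_quotient_topology: "topspace (quotient_topology X f) = f ` topspace X"
proof (rule antisym)
  show "topspace (quotient_topology X f) \<subseteq> f ` topspace X"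
    using openin_topspace[of "quotient_topology X f"]
    by (simp only: openin_quotient_topology)
  have "{x \<in> topspace X. f x \<in> f ` topspace X} = topspace X" by blast
  then show "f ` topspace X \<subseteq> topspace (quotient_topology X f)"
    by (intro openin_subset) (simp only: openin_quotient_topology openin_topspace order_refl)
qed

lemma quotient_map_quotient_topology: "quotient_map X (quotient_topology X f) f"
  unfolding quotient_map_def topspace_quotient_topology openin_quotient_topology by blast


section \<open>The group \<open>PSL\<^sub>2(\<real>)\<close>\<close>

definition SL2R :: "(real^2^2) monoid" where
  "SL2R = \<lparr>carrier = {A. det A = 1}, monoid.mult = (**), one = mat 1\<rparr>"

definition PSL2R :: "(real^2^2) set monoid" where
  "PSL2R = SL2R Mod {mat 1, - mat 1}"

definition psl :: "real^2^2 \<Rightarrow> (real^2^2) set" where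
  "psl A = {mat 1, - mat 1} #>\<^bsub>SL2R\<^esub> A"

definition PSL2R_topology :: "(real^2^2) set topology" where
  "PSL2R_topology = quotient_topology (top_of_set (carrier SL2R)) psl"

definition fuchsian :: "(real^2^2) set set \<Rightarrow> bool" where
  "fuchsian \<Phi> \<longleftrightarrow> subgroup \<Phi> PSL2R \<and> subtopology PSL2R_topology \<Phi> = discrete_topology \<Phi>"

lemma neg_matrix_mult: "(- A) ** B = - (A ** B)" "A ** (- B) = - (A ** B)"
  for A B :: "real^2^2"
  by (simp_all add: vec_eq_iff matrix_matrix_mult_def sum_2)

lemma det_neg_2: "det (- A) = det A" for A :: "real^2^2"
  by (simp add: det_2)

lemma psl_eq: "psl A = {A, - A}"
  by (auto simp: psl_def r_coset_def SL2R_def neg_matrix_mult)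

lemma group_SL2R: "group SL2R"
proof (rule groupI)
  fix A assume "A \<in> carrier SL2R"
  then have A: "det A = 1" by (simp add: SL2R_def)
  then have "invertible A" by (simp add: invertible_det_nz)
  then obtain B where B: "B ** A = mat 1" by (auto simp: invertible_def)
  then have "det (B ** A) = 1" by simp
  then have "det B = 1" by (simp add: det_mul A)
  with A B show "\<exists>B\<in>carrier SL2R. B \<otimes>\<^bsub>SL2R\<^esub> A = \<one>\<^bsub>SL2R\<^esub>"
    by (auto simp: SL2R_def)
qed (auto simp: SL2R_def det_mul matrix_mul_assoc)

lemma normal_SL2R: "normal {mat 1, - mat 1} SL2R"
proof -
  interpret group SL2R by (rule group_SL2R)
  have "inv\<^bsub>SL2R\<^esub> (- mat 1) = - mat 1"
    by (rule inv_equality) (auto simp: SL2R_def neg_matrix_mult det_neg_2)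
  moreover have "inv\<^bsub>SL2R\<^esub> (mat 1) = mat 1"
    using inv_one by (simp add: SL2R_def)
  ultimately have "subgroup {mat 1, - mat 1} SL2R"
    by (intro subgroupI) (auto simp: SL2R_def neg_matrix_mult det_neg_2)
  then show ?thesis
    by (rule normalI) (auto simp: r_coset_def l_coset_def SL2R_def neg_matrix_mult)
qed

lemma group_PSL2R: "group PSL2R"
  unfolding PSL2R_def by (rule normal.factorgroup_is_group[OF normal_SL2R])

lemma carrier_PSL2R: "carrier PSL2R = psl ` carrier SL2R"
  by (auto simp: PSL2R_def FactGroup_def RCOSETS_def psl_def)

lemma psl_mult:
  "A \<in> carrier SL2R \<Longrightarrow> B \<in> carrier SL2R \<Longrightarrow> psl A \<otimes>\<^bsub>PSL2R\<^esub> psl B = psl (A ** B)"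
  using normal.rcos_sum[OF normal_SL2R, of A B]
  by (simp add: PSL2R_def FactGroup_def psl_def SL2R_def)


section \<open>The upper half-plane\<close>

definition upper_half_plane :: "complex set" where
  "upper_half_plane = {z. Im z > 0}"

definition hyp_dist :: "complex \<Rightarrow> complex \<Rightarrow> real" where
  "hyp_dist z w = arcosh (1 + (cmod (z - w))\<^sup>2 / (2 * Im z * Im w))"

definition mat_action :: "real^2^2 \<Rightarrow> complex \<Rightarrow> complex" where
  "mat_action A =
     moebius (of_real (A$1$1)) (of_real (A$1$2)) (of_real (A$2$1)) (of_real (A$2$2))"

text \<open>The two representatives of an element of \<open>PSL\<^sub>2(\<real>)\<close> act in the same way
  (see \<open>psl_action_psl\<close> below), so the image is a singleton.\<close>

definition psl_action :: "(real^2^2) set \<Rightarrow> complex \<Rightarrow> complex" where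
  "psl_action g z = the_elem ((\<lambda>A. mat_action A z) ` g)"

lemma psl_action_psl: "psl_action (psl A) z = mat_action A z"
proof -
  have "mat_action (- A) z = mat_action A z"
  proof -
    have "mat_action (- A) z =
        (- (A$1$1 * z + A$1$2)) / (- (A$2$1 * z + A$2$2))"
      by (simp add: mat_action_def moebius_def algebra_simps)
    also have "\<dots> = mat_action A z"
      by (simp only: mat_action_def moebius_def minus_divide_divide)
    finally show ?thesis .
  qed
  then show ?thesis by (simp add: psl_action_def psl_eq)
qed

text \<open>The next three facts say that \<open>PSL\<^sub>2(\<real>)\<close> acts on the upper half-plane by isometries of
  \<open>hyp_dist\<close>, and that along the imaginary axis \<open>hyp_dist\<close> is the length for the metric
  \<open>\<bar>dz\<bar> / Im z\<close>, which fixes the normalization to curvature \<open>-1\<close>.\<close>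

lemma Im_mat_action:
  fixes A :: "real^2^2" and z :: complex
  assumes "det A = 1"
  shows "Im (mat_action A z) = Im z / (cmod (A$2$1 * z + A$2$2))\<^sup>2"
proof -
  define a b c d where "a = A$1$1" "b = A$1$2" "c = A$2$1" "d = A$2$2"
  have D: "a * d - b * c = 1" using assms by (simp add: det_2 a_b_c_d_def)
  have "Im (mat_action A z) =
      (a * Im z * (c * Re z + d) - (a * Re z + b) * (c * Im z)) / (cmod (c * z + d))\<^sup>2"
    by (simp add: mat_action_def moebius_def Im_divide cmod_power2 a_b_c_d_def)
  also have "a * Im z * (c * Re z + d) - (a * Re z + b) * (c * Im z) = (a * d - b * c) * Im z"
    by (simp add: algebra_simps)
  finally show ?thesis using D by (simp add: a_b_c_d_def)
qed

lemma mat_action_denom_nonzero: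
  fixes A :: "real^2^2" and z :: complex
  assumes "det A = 1" "z \<in> upper_half_plane"
  shows "complex_of_real (A$2$1) * z + of_real (A$2$2) \<noteq> 0"
  using assms by (auto simp: complex_eq_iff upper_half_plane_def det_2)

lemma mat_action_upper_half_plane:
  fixes A :: "real^2^2" and z :: complex
  assumes "det A = 1" "z \<in> upper_half_plane"
  shows "mat_action A z \<in> upper_half_plane"
  using mat_action_denom_nonzero[OF assms] assms Im_mat_action[OF assms(1)]
  by (simp add: upper_half_plane_def)

lemma hyp_dist_mat_action:
  fixes A :: "real^2^2" and z w :: complex
  assumes A: "det A = 1" and z: "z \<in> upper_half_plane" and w: "w \<in> upper_half_plane"
  shows "hyp_dist (mat_action A z) (mat_action A w) = hyp_dist z w"
proof -
  define a b c d where "a = complex_of_real (A$1$1)" "b = complex_of_real (A$1$2)"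
    "c = complex_of_real (A$2$1)" "d = complex_of_real (A$2$2)"
  have D: "a * d - b * c = 1"
    using arg_cong[OF A, of complex_of_real] by (simp add: det_2 a_b_c_d_def)
  define p q where "p = c * z + d" "q = c * w + d"
  have p: "p \<noteq> 0" and q: "q \<noteq> 0"
    using mat_action_denom_nonzero[OF A z] mat_action_denom_nonzero[OF A w]
    by (simp_all add: p_q_def a_b_c_d_def)
  have "mat_action A z - mat_action A w = ((a * z + b) * q - (a * w + b) * p) / (p * q)"
    using p q by (simp add: mat_action_def moebius_def p_q_def a_b_c_d_def diff_frac_eq)
  also have "(a * z + b) * q - (a * w + b) * p = (a * d - b * c) * (z - w)"
    by (simp add: p_q_def algebra_simps)
  finally have "cmod (mat_action A z - mat_action A w) = cmod (z - w) / (cmod p * cmod q)"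
    by (simp add: D norm_divide norm_mult)
  moreover have "Im (mat_action A z) = Im z / (cmod p)\<^sup>2" "Im (mat_action A w) = Im w / (cmod q)\<^sup>2"
    using Im_mat_action[OF A] by (simp_all add: p_q_def a_b_c_d_def)
  moreover have "(X / (P * Q))\<^sup>2 / (2 * (Y / P\<^sup>2) * (Z / Q\<^sup>2)) = X\<^sup>2 / (2 * Y * Z)"
    if "P \<noteq> 0" "Q \<noteq> 0" for P Q X Y Z :: real
    using that by (simp add: power_divide power_mult_distrib)
  from this[of "cmod p" "cmod q" "cmod (z - w)" "Im z" "Im w"]
  have "(cmod (z - w) / (cmod p * cmod q))\<^sup>2 /
      (2 * (Im z / (cmod p)\<^sup>2) * (Im w / (cmod q)\<^sup>2)) = (cmod (z - w))\<^sup>2 / (2 * Im z * Im w)"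
    using p q by simp
  ultimately show ?thesis by (simp only: hyp_dist_def)
qed

lemma hyp_dist_imaginary_axis:
  assumes "0 < s" "s \<le> t"
  shows "hyp_dist (Complex 0 s) (Complex 0 t) = ln t - ln s"
proof -
  have "cmod (Complex 0 s - Complex 0 t) ^ 2 = (t - s)\<^sup>2"
    by (simp add: cmod_power2 power2_commute)
  then have "hyp_dist (Complex 0 s) (Complex 0 t) = arcosh (1 + (t - s)\<^sup>2 / (2 * s * t))"
    by (simp add: hyp_dist_def)
  also have "1 + (t - s)\<^sup>2 / (2 * s * t) = cosh (ln (t / s))"
    using assms by (simp add: cosh_ln_real field_simps power2_eq_square)
  also have "arcosh \<dots> = ln (t / s)"
    using assms by (simp add: arcosh_cosh_real)
  finally show ?thesis using assms by (simp add: ln_div)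
qed


section \<open>Free generation\<close>

text \<open>A word is a list of letters \<open>(x, e)\<close>, standing for \<open>x\<close> if \<open>e\<close> holds and for the formal
  inverse of \<open>x\<close> otherwise.  The set \<open>S\<close> freely generates \<open>G\<close> if every element of \<open>G\<close> is the value
  of exactly one reduced word over \<open>S\<close>.\<close>

definition reduced_words :: "'a set \<Rightarrow> ('a \<times> bool) list set" where
  "reduced_words S = {w. fst ` set w \<subseteq> S \<and>
     successively (\<lambda>p q. \<not> (fst p = fst q \<and> snd p \<noteq> snd q)) w}"

definition word_value :: "('a, 'b) monoid_scheme \<Rightarrow> ('a \<times> bool) list \<Rightarrow> 'a" where
  "word_value G w =
     foldr (\<lambda>(x, e) y. (if e then x else inv\<^bsub>G\<^esub> x) \<otimes>\<^bsub>G\<^esub> y) w \<one>\<^bsub>G\<^esub>"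

definition freely_generated :: "('a, 'b) monoid_scheme \<Rightarrow> 'a set \<Rightarrow> bool" where
  "freely_generated G S \<longleftrightarrow>
     S \<subseteq> carrier G \<and> bij_betw (word_value G) (reduced_words S) (carrier G)"


section \<open>Principal congruence subgroups\<close>

text \<open>The image in \<open>PSL\<^sub>2(\<real>)\<close> of the integer matrices of determinant \<open>1\<close> congruent to the
  identity modulo \<open>N\<close>.\<close>

definition principal_congruence :: "int \<Rightarrow> (real^2^2) set set" where
  "principal_congruence N = psl ` {A \<in> carrier SL2R.
     \<forall>i j. \<exists>m::int. A $ i $ j = mat 1 $ i $ j + of_int (N * m)}"

end

theory Submission
  imports Defs
begin

text \<open>Let \<open>B(z)\<close> be a hyperbolic disc of fixed radius about \<open>z\<close>. For every letter \<open>x\<close> let \<open>f\<^sub>x\<close> be a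
  measurable version of ``\<open>p\<close> lies in the image of the fundamental domain under a reduced word
  beginning with \<open>x\<close>''. Then \<open>f\<^sub>x(x p) + f\<^bsub>x\<^sup>-\<^sup>1\<^esub>(p) = 1\<close> and \<open>\<Sum>\<^sub>x f\<^sub>x \<le> 1\<close>, and since the area is
  invariant, integrating these relations over \<open>B(z) \<inter> B(g\<^sub>i z)\<close> gives
  \<open>\<Sum>\<^sub>i area (B(z) \<inter> B(g\<^sub>i z)) \<le> area (B(z))\<close>. As the radius tends to infinity, the normalised
  area of \<open>B(z) \<inter> B(w)\<close> tends to the integral over the boundary of the minimum of the Poisson
  kernels at \<open>z\<close> and \<open>w\<close>, which is \<open>4 arccos (tanh (d(z, w) / 2))\<close> if the total mass is \<open>2 \<pi>\<close>.

  For \<open>\<Gamma>(2)\<close>, generation is the Euclidean algorithm and freeness is ping-pong.\<close>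

section \<open>Hyperbolic area\<close>

text \<open>The boundary measures with Poisson densities are only carried into one another by the
  group. The decomposition by first letters is therefore applied inside the plane, where the area is
  preserved, and it reaches the boundary only in the limit: the area of a large disc concentrates
  near its rim, so normalised areas turn into boundary integrals. Each generator g is charged once.
  With h the inverse letter, every p in both B(z) and B(g z) satisfies f_g(p) + f_h(g^-1 p) = 1, and
  g^-1 p lies again in B(z). Hence the area of the intersection is at most the integral of f_g + f_h
  over B(z), and over all generators each letter occurs exactly once. In the limit, the disc
  compared with itself contributes 4 arccos (tanh 0) = 2 \<pi>; division by four gives the bound
  \<pi> / 2.\<close>

text \<open>In the coordinates \<open>p = exp t (c + \<i>)\<close> the area form \<open>dx dy / y\<^sup>2\<close> is \<open>dc dt\<close>, and translations,
  homotheties and \<open>p \<mapsto> - 1 / p\<close> become shears, shifts and the reflection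
  \<open>(c, t) \<mapsto> (- c, - t - ln (1 + c\<^sup>2))\<close>.\<close>

definition horo :: "real \<times> real \<Rightarrow> complex" where
  "horo = (\<lambda>(c, t). Complex (c * exp t) (exp t))"

definition hyp_area :: "complex measure" where
  "hyp_area = distr (lborel \<Otimes>\<^sub>M lborel) (restrict_space borel upper_half_plane) horo"

lemma space_hyp_area [simp]: "space hyp_area = upper_half_plane"
  by (simp add: hyp_area_def space_restrict_space)

lemma sets_hyp_area [measurable_cong]:
  "sets hyp_area = sets (restrict_space borel upper_half_plane)"
  by (simp add: hyp_area_def)

lemma horo_measurable:
  "horo \<in> lborel \<Otimes>\<^sub>M lborel \<rightarrow>\<^sub>M restrict_space borel upper_half_plane"
proof (rule measurable_restrict_space2)
  have "continuous_on UNIV horo"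
    unfolding horo_def Complex_eq case_prod_beta by (intro continuous_intros)
  then have "horo \<in> borel_measurable borel"
    by (rule borel_measurable_continuous_onI)
  then show "horo \<in> borel_measurable (lborel \<Otimes>\<^sub>M lborel)"
    by (simp add: lborel_prod)
qed (auto simp: horo_def upper_half_plane_def)

lemma horo_measurable' [measurable]:
  "horo \<in> lborel \<Otimes>\<^sub>M lborel \<rightarrow>\<^sub>M hyp_area"
  using horo_measurable by (simp add: measurable_cong_sets[OF refl sets_hyp_area])

text \<open>The two orders of integration serve different isometries: translations move
  \<open>c\<close> by an amount depending on \<open>t\<close>, while the inversion moves
  \<open>t\<close> by an amount depending on \<open>c\<close>.\<close>

lemma nn_integral_hyp_area:
  assumes [measurable]: "f \<in> borel_measurable hyp_area"
  shows "(\<integral>\<^sup>+p. f p \<partial>hyp_area) = (\<integral>\<^sup>+c. \<integral>\<^sup>+t. f (horo (c, t)) \<partial>lborel \<partial>lborel)"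
    and "(\<integral>\<^sup>+p. f p \<partial>hyp_area) = (\<integral>\<^sup>+t. \<integral>\<^sup>+c. f (horo (c, t)) \<partial>lborel \<partial>lborel)"
proof -
  have "(\<integral>\<^sup>+p. f p \<partial>hyp_area) = (\<integral>\<^sup>+q. f (horo q) \<partial>(lborel \<Otimes>\<^sub>M lborel))"
    using assms unfolding hyp_area_def by (intro nn_integral_distr[OF horo_measurable])
  also have "\<dots> = (\<integral>\<^sup>+c. \<integral>\<^sup>+t. f (horo (c, t)) \<partial>lborel \<partial>lborel)"
    by (subst lborel.nn_integral_fst[symmetric]) auto
  finally show *: "(\<integral>\<^sup>+p. f p \<partial>hyp_area) = (\<integral>\<^sup>+c. \<integral>\<^sup>+t. f (horo (c, t)) \<partial>lborel \<partial>lborel)" .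
  show "(\<integral>\<^sup>+p. f p \<partial>hyp_area) = (\<integral>\<^sup>+t. \<integral>\<^sup>+c. f (horo (c, t)) \<partial>lborel \<partial>lborel)"
    unfolding * by (rule lborel_pair.Fubini[symmetric]) measurable
qed

lemma mat_action_measurable:
  assumes "det A = 1"
  shows "mat_action A \<in> hyp_area \<rightarrow>\<^sub>M hyp_area"
proof -
  have "mat_action A \<in> borel_measurable borel"
    unfolding mat_action_def moebius_def by measurable
  then have "mat_action A \<in> restrict_space borel upper_half_plane \<rightarrow>\<^sub>M restrict_space borel upper_half_plane"
    using mat_action_upper_half_plane[OF assms]
    by (intro measurable_restrict_space2 measurable_restrict_space1)
       (auto simp: space_restrict_space)
  then show ?thesis
    by (simp add: measurable_cong_sets[OF sets_hyp_area sets_hyp_area])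
qed

lemma horo_section_measurable:
  assumes "f \<in> borel_measurable hyp_area"
  shows "(\<lambda>t. f (horo (c, t))) \<in> borel_measurable borel"
    and "(\<lambda>c. f (horo (c, t))) \<in> borel_measurable borel"
proof -
  have "(\<lambda>q. f (horo q)) \<in> borel_measurable (lborel \<Otimes>\<^sub>M lborel)"
    using assms by measurable
  from measurable_Pair2[OF this, of c] measurable_Pair1[OF this, of t]
  show "(\<lambda>t. f (horo (c, t))) \<in> borel_measurable borel"
    and "(\<lambda>c. f (horo (c, t))) \<in> borel_measurable borel" by simp_all
qed

lemma nn_integral_hyp_area_translate:
  assumes f: "f \<in> borel_measurable hyp_area" and "(\<lambda>p. f (p + of_real b)) \<in> borel_measurable hyp_area"
  shows "(\<integral>\<^sup>+p. f (p + of_real b) \<partial>hyp_area) = (\<integral>\<^sup>+p. f p \<partial>hyp_area)"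
proof -
  have "horo (c, t) + of_real b = horo (b * exp (- t) + 1 * c, t)" for c t
    by (simp add: horo_def complex_eq_iff exp_minus field_simps)
  then show ?thesis
    unfolding nn_integral_hyp_area(2)[OF f] nn_integral_hyp_area(2)[OF assms(2)]
    using nn_integral_real_affine[OF horo_section_measurable(2)[OF f], where c = 1]
    by simp
qed

lemma nn_integral_hyp_area_scale:
  assumes f: "f \<in> borel_measurable hyp_area" and "(\<lambda>p. f (of_real r * p)) \<in> borel_measurable hyp_area"
    and r: "r > 0"
  shows "(\<integral>\<^sup>+p. f (of_real r * p) \<partial>hyp_area) = (\<integral>\<^sup>+p. f p \<partial>hyp_area)"
proof -
  have "of_real r * horo (c, t) = horo (c, ln r + 1 * t)" for c t
    using r by (simp add: horo_def complex_eq_iff exp_add)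
  then show ?thesis
    unfolding nn_integral_hyp_area(1)[OF f] nn_integral_hyp_area(1)[OF assms(2)]
    using nn_integral_real_affine[OF horo_section_measurable(1)[OF f], where c = 1]
    by simp
qed

lemma nn_integral_hyp_area_inversion:
  assumes f: "f \<in> borel_measurable hyp_area" and "(\<lambda>p. f (- 1 / p)) \<in> borel_measurable hyp_area"
  shows "(\<integral>\<^sup>+p. f (- 1 / p) \<partial>hyp_area) = (\<integral>\<^sup>+p. f p \<partial>hyp_area)"
proof -
  \<comment> \<open>The squared modulus of \<open>horo (c, t)\<close> is
    \<open>(1 + c\<^sup>2) * exp (2 * t)\<close>. Dividing by it turns the height
    \<open>exp t\<close> into \<open>exp (- t) / (1 + c\<^sup>2)\<close>, whereas \<open>c\<close>,
    the ratio of real to imaginary part, only changes sign.\<close>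
  have *: "- 1 / horo (c, t) = horo (0 + (- 1) * c, - ln (1 + c\<^sup>2) + (- 1) * t)" for c t
  proof -
    have "exp (- ln (1 + c\<^sup>2) + (- 1) * t) = 1 / ((1 + c\<^sup>2) * exp t)"
      using add_pos_nonneg[of 1 "c\<^sup>2"]
      by (simp add: exp_add exp_diff exp_minus field_simps)
    moreover have "(c * exp t)\<^sup>2 + (exp t)\<^sup>2 = (1 + c\<^sup>2) * exp t * exp t"
      by (simp add: power2_eq_square algebra_simps)
    moreover have "1 + c\<^sup>2 \<noteq> 0" using zero_le_power2[of c] by linarith
    ultimately show ?thesis
      by (simp add: horo_def complex_eq_iff Re_divide Im_divide)
  qed
  have "(\<integral>\<^sup>+p. f (- 1 / p) \<partial>hyp_area) =
      (\<integral>\<^sup>+c. \<integral>\<^sup>+t. f (horo (0 + (- 1) * c, - ln (1 + c\<^sup>2) + (- 1) * t)) \<partial>lborel \<partial>lborel)"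
    unfolding nn_integral_hyp_area(1)[OF assms(2)] by (simp only: *)
  also have "\<dots> = (\<integral>\<^sup>+c. \<integral>\<^sup>+t. f (horo (0 + (- 1) * c, t)) \<partial>lborel \<partial>lborel)"
    using nn_integral_real_affine[OF horo_section_measurable(1)[OF f], where c = "- 1"]
    by (simp del: mult_minus1 add: ennreal_1)
  also have "\<dots> = (\<integral>\<^sup>+c. \<integral>\<^sup>+t. f (horo (c, t)) \<partial>lborel \<partial>lborel)"
  proof -
    have [measurable]: "(\<lambda>c. \<integral>\<^sup>+t. f (horo (c, t)) \<partial>lborel) \<in> borel_measurable borel"
      using lborel.borel_measurable_nn_integral_fst[of "\<lambda>q. f (horo q)" lborel] f by simp
    show ?thesis
      using nn_integral_real_affine[of "\<lambda>c. \<integral>\<^sup>+t. f (horo (c, t)) \<partial>lborel" "- 1" 0]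
      by (simp add: ennreal_1)
  qed
  finally show ?thesis
    unfolding nn_integral_hyp_area(1)[OF f] .
qed

text \<open>Bruhat decomposition: if the lower left entry vanishes, the map is a homothety followed
  by a translation; otherwise it is a translation, the inversion, a homothety and a second
  translation, composed in this order. Invariance under these three kinds of maps is already
  known.\<close>

lemma nn_integral_hyp_area_mat_action:
  assumes A: "det A = 1" and f: "f \<in> borel_measurable hyp_area"
  shows "(\<integral>\<^sup>+p. f (mat_action A p) \<partial>hyp_area) = (\<integral>\<^sup>+p. f p \<partial>hyp_area)"
proof -
  define a b c d where abcd: "a = A$1$1" "b = A$1$2" "c = A$2$1" "d = A$2$2"
  have D: "a * d - b * c = 1" using A by (simp add: det_2 abcd)
  have act: "mat_action A p = (a * p + b) / (c * p + d)" for p :: complex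
    by (simp add: mat_action_def moebius_def abcd)
  have tr: "(\<lambda>p. p + of_real s) \<in> hyp_area \<rightarrow>\<^sub>M hyp_area" for s :: real
    using mat_action_measurable[of "vector [vector [1, s], vector [0, 1]]"]
    by (simp add: det_2 mat_action_def moebius_def[abs_def])
  have inv: "(\<lambda>p. - 1 / p) \<in> hyp_area \<rightarrow>\<^sub>M hyp_area"
    using mat_action_measurable[of "vector [vector [0, - 1], vector [1, 0]]"]
    by (simp add: det_2 mat_action_def moebius_def[abs_def])
  have sc: "(\<lambda>p. of_real r * p) \<in> hyp_area \<rightarrow>\<^sub>M hyp_area" if "r > 0" for r :: real
    using mat_action_measurable[of "vector [vector [sqrt r, 0], vector [0, 1 / sqrt r]]"] that
    by (simp add: det_2 mat_action_def moebius_def[abs_def] mult_ac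
        flip: of_real_mult)
  note mc = measurable_compose
  show ?thesis
  proof (cases "c = 0")
    case True
    with D have "a \<noteq> 0" by auto
    moreover from this have "d = 1 / a" using D True by (simp add: field_simps)
    ultimately have "mat_action A p = of_real (a\<^sup>2) * p + of_real (a * b)" for p
      using True by (simp add: act power2_eq_square algebra_simps)
    note act' = this
    have pos: "a\<^sup>2 > 0" using \<open>a \<noteq> 0\<close> by simp
    note m = mc[OF tr f, of "a * b"]
    show ?thesis
      unfolding act'
      using nn_integral_hyp_area_scale[OF m mc[OF sc[OF pos] m] pos]
        nn_integral_hyp_area_translate[OF f m] by simp
  next
    case False
    have e: "mat_action A p = of_real (1 / c\<^sup>2) * (- 1 / (p + of_real (d / c))) + of_real (a / c)"
      if "p \<in> upper_half_plane" for p
    proof -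
      have split_frac: "N / q = 1 / c'\<^sup>2 * (- 1 / (q / c')) + a' / c'"
        if "q \<noteq> 0" "c' \<noteq> 0" "c' * N = a' * q - 1" for N q a' c' :: complex
      proof -
        have "N / q = (c' * N) / (c' * q)" using that(1,2) by simp
        also have "\<dots> = (a' * q - 1) / (c' * q)" by (simp only: that(3))
        also have "\<dots> = 1 / c'\<^sup>2 * (- 1 / (q / c')) + a' / c'"
          using that(1,2) by (simp add: field_simps power2_eq_square)
        finally show ?thesis .
      qed
      have "complex_of_real a * d - b * c = 1"
        using arg_cong[OF D, of complex_of_real] by simp
      then have "of_real c * (a * p + b) = a * (c * p + d) - 1" by (simp add: algebra_simps)
      moreover have "p + of_real (d / c) = (c * p + d) / c" using False by (simp add: field_simps)
      moreover have "c * p + d \<noteq> 0"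
        using mat_action_denom_nonzero[OF A that] by (simp add: abcd)
      ultimately show ?thesis
        using split_frac[of "c * p + d" c "a * p + b" a] False by (simp add: act)
    qed
    have pos: "1 / c\<^sup>2 > 0" using False by simp
    note m1 = mc[OF tr f, of "a / c"]
    note m2 = mc[OF sc[OF pos] m1]
    note m3 = mc[OF inv m2]
    note m4 = mc[OF tr m3, of "d / c"]
    have "(\<integral>\<^sup>+p. f (mat_action A p) \<partial>hyp_area) =
      (\<integral>\<^sup>+p. f (of_real (1 / c\<^sup>2) * (- 1 / (p + of_real (d / c))) + of_real (a / c)) \<partial>hyp_area)"
      by (intro nn_integral_cong) (simp add: e)
    also have "\<dots> = (\<integral>\<^sup>+p. f p \<partial>hyp_area)"
      using nn_integral_hyp_area_translate[OF m3 m4] nn_integral_hyp_area_inversion[OF m2 m3]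
        nn_integral_hyp_area_scale[OF m1 m2 pos] nn_integral_hyp_area_translate[OF f m1]
      by simp
    finally show ?thesis .
  qed
qed

section \<open>Large discs and Poisson kernels\<close>

text \<open>This is \<open>2 \<pi>\<close> times the Poisson kernel of the upper half-plane.\<close>

definition poisson :: "complex \<Rightarrow> real \<Rightarrow> real" where
  "poisson z x = 2 * Im z / ((x - Re z)\<^sup>2 + (Im z)\<^sup>2)"

definition overlap :: "complex \<Rightarrow> complex \<Rightarrow> ennreal" where
  "overlap z w = (\<integral>\<^sup>+x. ennreal (min (poisson z x) (poisson w x)) \<partial>lborel)"

text \<open>With this choice of radius, the condition \<open>p \<in> hball z M\<close> reads
  \<open>\<bar>p - cnj z\<bar>\<^sup>2 \<le> 2 M Im z Im p\<close>; after substituting \<open>Im p = exp t / M\<close> it is monotone in \<open>M\<close>.\<close>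

definition hball :: "complex \<Rightarrow> real \<Rightarrow> complex set" where
  "hball z M = {p \<in> upper_half_plane. cosh (hyp_dist z p) + 1 \<le> M}"

lemma cosh_hyp_dist:
  assumes "z \<in> upper_half_plane" "w \<in> upper_half_plane"
  shows "cosh (hyp_dist z w) = 1 + (cmod (z - w))\<^sup>2 / (2 * Im z * Im w)"
  using assms by (simp add: hyp_dist_def upper_half_plane_def cosh_arcosh_real)

lemma hyp_dist_nonneg:
  assumes "z \<in> upper_half_plane" "w \<in> upper_half_plane"
  shows "hyp_dist z w \<ge> 0"
  using assms by (simp add: hyp_dist_def upper_half_plane_def arcosh_nonneg_real)

lemma mem_hball_iff:
  assumes "z \<in> upper_half_plane" "p \<in> upper_half_plane"
  shows "p \<in> hball z M \<longleftrightarrow> (Re p - Re z)\<^sup>2 + (Im p + Im z)\<^sup>2 \<le> 2 * M * Im z * Im p"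
proof -
  have "Im z > 0" "Im p > 0" using assms by (auto simp: upper_half_plane_def)
  then have "2 * Im z * Im p > 0" by simp
  have "p \<in> hball z M \<longleftrightarrow> (cmod (z - p))\<^sup>2 / (2 * Im z * Im p) \<le> M - 2"
    using assms by (auto simp: hball_def cosh_hyp_dist)
  also have "\<dots> \<longleftrightarrow> (cmod (z - p))\<^sup>2 \<le> (M - 2) * (2 * Im z * Im p)"
    by (rule pos_divide_le_eq) fact
  also have "\<dots> \<longleftrightarrow> (Re p - Re z)\<^sup>2 + (Im p + Im z)\<^sup>2 \<le> 2 * M * Im z * Im p"
    unfolding cmod_power2 minus_complex.simps by (simp add: power2_eq_square algebra_simps)
  finally show ?thesis .
qed

lemma hball_sets [measurable]:
  assumes "z \<in> upper_half_plane"
  shows "hball z M \<in> sets hyp_area"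
proof -
  have "hball z M = upper_half_plane \<inter>
      {p. (Re p - Re z)\<^sup>2 + (Im p + Im z)\<^sup>2 \<le> 2 * M * Im z * Im p}"
    using mem_hball_iff[OF assms] by (auto simp: hball_def)
  moreover have "closed {p. (Re p - Re z)\<^sup>2 + (Im p + Im z)\<^sup>2 \<le> 2 * M * Im z * Im p}"
    by (intro closed_Collect_le continuous_intros)
  ultimately show ?thesis
    by (auto simp: sets_hyp_area sets_restrict_space)
qed

lemma mat_action_mem_hball_iff:
  assumes "det A = 1" "z \<in> upper_half_plane" "p \<in> upper_half_plane"
  shows "mat_action A p \<in> hball (mat_action A z) M \<longleftrightarrow> p \<in> hball z M"
  using assms by (simp add: hball_def mat_action_upper_half_plane hyp_dist_mat_action)

text \<open>With y = exp t / M, the area form dx dy / y^2 becomes M exp (-t) dx dt. After the factor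
  M is taken out, the remaining measure no longer depends on the disc, so that the sets alone vary
  in the limit.\<close>

definition horo_measure :: "(real \<times> real) measure" where
  "horo_measure = density (lborel \<Otimes>\<^sub>M lborel) (\<lambda>(x, t). ennreal (exp (- t)))"

lemma sets_horo_measure [measurable_cong, simp]:
  "sets horo_measure = sets (lborel \<Otimes>\<^sub>M lborel)"
  by (simp add: horo_measure_def)

lemma emeasure_horo_measure:
  assumes [measurable]: "S \<in> sets (lborel \<Otimes>\<^sub>M lborel)"
  shows "emeasure horo_measure S =
    (\<integral>\<^sup>+x. \<integral>\<^sup>+t. ennreal (exp (- t)) * indicator S (x, t) \<partial>lborel \<partial>lborel)"
proof -
  have "emeasure horo_measure S =
      (\<integral>\<^sup>+q. ennreal (exp (- snd q)) * indicator S q \<partial>(lborel \<Otimes>\<^sub>M lborel))"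
    unfolding horo_measure_def by (subst emeasure_density) (use assms in \<open>auto simp: case_prod_unfold\<close>)
  also have "\<dots> = (\<integral>\<^sup>+x. \<integral>\<^sup>+t. ennreal (exp (- snd (x, t))) * indicator S (x, t) \<partial>lborel \<partial>lborel)"
    by (rule lborel.nn_integral_fst[symmetric]) measurable
  finally show ?thesis by simp
qed

lemma emeasure_hyp_area:
  assumes E: "E \<in> sets hyp_area" and M: "M > 0"
  shows "{(x, t). Complex x (exp t / M) \<in> E} \<in> sets (lborel \<Otimes>\<^sub>M lborel)" (is "?S \<in> _")
    and "emeasure hyp_area E =
      ennreal M * emeasure horo_measure {(x, t). Complex x (exp t / M) \<in> E}"
proof -
  define T where "T m = {(x, t). Complex x (exp t / m) \<in> E}" for m :: real
  have "upper_half_plane \<in> sets borel"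
    unfolding upper_half_plane_def by (intro borel_open open_halfspace_Im_gt)
  then have E': "E \<in> sets borel"
    using E by (auto simp: sets_hyp_area sets_restrict_space)
  have T: "T m \<in> sets (lborel \<Otimes>\<^sub>M lborel)" if "m > 0" for m
  proof -
    have "continuous_on UNIV (\<lambda>q. Complex (fst q) (exp (snd q) / m))"
      unfolding Complex_eq by (intro continuous_intros) (use that in auto)
    then have "(\<lambda>q. Complex (fst q) (exp (snd q) / m)) \<in> borel_measurable borel"
      by (rule borel_measurable_continuous_onI)
    from measurable_sets[OF this E'] have "T m \<in> sets borel"
      by (simp add: T_def vimage_def case_prod_unfold)
    then show ?thesis by (simp only: lborel_prod sets_lborel)
  qed
  then show "?S \<in> sets (lborel \<Otimes>\<^sub>M lborel)" using M by (simp add: T_def)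
  note [measurable] = T[OF M] T[of 1, simplified] E
  have [measurable]: "indicator E \<in> borel_measurable hyp_area" by measurable
  have sm: "(\<lambda>c. indicator E (horo (c, t)) :: ennreal) \<in> borel_measurable borel" for t
    by (rule horo_section_measurable) simp
  have "emeasure hyp_area E = (\<integral>\<^sup>+p. indicator E p \<partial>hyp_area)"
    using E by simp
  also have "\<dots> = (\<integral>\<^sup>+t. \<integral>\<^sup>+c. indicator E (horo (c, t)) \<partial>lborel \<partial>lborel)"
    by (rule nn_integral_hyp_area) measurable
  \<comment> \<open>For fixed \<open>t\<close> the substitution \<open>c = exp (- t) * x\<close>
    returns to the Euclidean abscissa; its Jacobian is the density of
    \<open>horo_measure\<close>.\<close>
  also have "\<dots> = (\<integral>\<^sup>+t. \<integral>\<^sup>+x. ennreal (exp (- t)) * indicator (T 1) (x, t) \<partial>lborel \<partial>lborel)"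
  proof (rule nn_integral_cong)
    fix t :: real
    have "(\<integral>\<^sup>+c. indicator E (horo (c, t)) \<partial>lborel) =
        ennreal \<bar>exp (- t)\<bar> * (\<integral>\<^sup>+x. indicator E (horo (0 + exp (- t) * x, t)) \<partial>lborel)"
      by (rule nn_integral_real_affine[OF sm]) simp
    also have "\<dots> = ennreal (exp (- t)) * (\<integral>\<^sup>+x. indicator (T 1) (x, t) \<partial>lborel)"
    proof -
      have cancel: "exp (- t) * x * exp t = x" for x :: real
        by (simp add: exp_minus)
      show ?thesis by (simp add: horo_def T_def indicator_def cancel)
    qed
    also have "\<dots> = (\<integral>\<^sup>+x. ennreal (exp (- t)) * indicator (T 1) (x, t) \<partial>lborel)"
      by (rule nn_integral_cmult[symmetric]) measurable
    finally show "(\<integral>\<^sup>+c. indicator E (horo (c, t)) \<partial>lborel) =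
      (\<integral>\<^sup>+x. ennreal (exp (- t)) * indicator (T 1) (x, t) \<partial>lborel)" .
  qed
  also have "\<dots> = (\<integral>\<^sup>+x. \<integral>\<^sup>+t. ennreal (exp (- t)) * indicator (T 1) (x, t) \<partial>lborel \<partial>lborel)"
    by (rule lborel_pair.Fubini') measurable
  \<comment> \<open>Shifting \<open>t\<close> by \<open>ln M\<close> replaces the height
    \<open>exp t\<close> by \<open>exp t / M\<close> and extracts the factor \<open>M\<close> from
    the density.\<close>
  also have "\<dots> = (\<integral>\<^sup>+x. ennreal M * (\<integral>\<^sup>+t. ennreal (exp (- t)) * indicator (T M) (x, t) \<partial>lborel) \<partial>lborel)"
  proof (rule nn_integral_cong)
    fix x :: real
    have "(\<integral>\<^sup>+t. ennreal (exp (- t)) * indicator (T 1) (x, t) \<partial>lborel) =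
      ennreal \<bar>1\<bar> * (\<integral>\<^sup>+t. ennreal (exp (- (- ln M + 1 * t))) * indicator (T 1) (x, - ln M + 1 * t) \<partial>lborel)"
      by (rule nn_integral_real_affine) auto
    also have "\<dots> = (\<integral>\<^sup>+t. ennreal M * (ennreal (exp (- t)) * indicator (T M) (x, t)) \<partial>lborel)"
    proof -
      have "exp (- (- ln M + 1 * t)) = M * exp (- t)" for t
        using M by (simp add: exp_diff exp_minus field_simps)
      moreover have "exp (- ln M + 1 * t) = exp t / M" for t
        using M by (simp add: exp_diff exp_minus exp_add field_simps)
      ultimately show ?thesis
        using M by (simp add: T_def indicator_def ennreal_mult mult.assoc)
    qed
    also have "\<dots> = ennreal M * (\<integral>\<^sup>+t. ennreal (exp (- t)) * indicator (T M) (x, t) \<partial>lborel)"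
      by (rule nn_integral_cmult) measurable
    finally show "(\<integral>\<^sup>+t. ennreal (exp (- t)) * indicator (T 1) (x, t) \<partial>lborel) =
      ennreal M * (\<integral>\<^sup>+t. ennreal (exp (- t)) * indicator (T M) (x, t) \<partial>lborel)" .
  qed
  also have "\<dots> = ennreal M * emeasure horo_measure (T M)"
  proof -
    have "(\<lambda>q. ennreal (exp (- snd q)) * indicator (T M) q) \<in> borel_measurable (lborel \<Otimes>\<^sub>M lborel)"
      by measurable
    from lborel.borel_measurable_nn_integral_fst[OF this] show ?thesis
      by (subst emeasure_horo_measure[OF T[OF M]], intro nn_integral_cmult) simp
  qed
  finally show "emeasure hyp_area E =
      ennreal M * emeasure horo_measure {(x, t). Complex x (exp t / M) \<in> E}"
    by (simp only: T_def)
qed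

lemma nn_integral_exp_minus_Ioi:
  "(\<integral>\<^sup>+t. ennreal (exp (- t)) * indicator {a<..} t \<partial>lborel) = ennreal (exp (- a))"
proof -
  have "(\<integral>\<^sup>+t. ennreal (exp (- t)) * indicator {a<..} t \<partial>lborel) =
      (\<integral>\<^sup>+t. ennreal (exp (- t)) * indicator {a..} t \<partial>lborel)"
    using AE_lborel_singleton[of a]
    by (intro nn_integral_cong_AE) (auto elim!: eventually_mono simp: indicator_def)
  also have "\<dots> = ennreal (0 - (- exp (- a)))"
  proof (rule nn_integral_FTC_atLeast)
    have "((\<lambda>t::real. exp (- t)) \<longlongrightarrow> 0) at_top"
      by (rule filterlim_compose[OF exp_at_bot filterlim_uminus_at_bot_at_top])
    from tendsto_minus[OF this] show "((\<lambda>t::real. - exp (- t)) \<longlongrightarrow> 0) at_top"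
      by simp
  qed (auto intro!: derivative_eq_intros)
  finally show ?thesis by simp
qed

lemma poisson_pos: "z \<in> upper_half_plane \<Longrightarrow> poisson z x > 0"
  by (auto simp: poisson_def upper_half_plane_def intro!: divide_pos_pos add_nonneg_pos)

lemma poisson_measurable [measurable]: "poisson z \<in> borel_measurable borel"
  unfolding poisson_def[abs_def] by measurable

text \<open>In the rescaled coordinates the discs form an increasing sequence of sets, so continuity
  of the measure from below applies. Their union is the set of all (x, t) for which exp (-t) lies
  below both Poisson kernels, and the integral of exp (-t) over this range of t is exactly the
  smaller kernel at x.\<close>

lemma emeasure_hball_tendsto_overlap:
  assumes z: "z \<in> upper_half_plane" and w: "w \<in> upper_half_plane"
  shows "(\<lambda>n. ennreal (1 / real (Suc n)) *
      emeasure hyp_area (hball z (real (Suc n)) \<inter> hball w (real (Suc n)))) \<longlonglongrightarrow> overlap z w"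
proof -
  define S where "S n = {(x, t). Complex x (exp t / real (Suc n)) \<in>
      hball z (real (Suc n)) \<inter> hball w (real (Suc n))}" for n
  define Q where "Q v n x t \<longleftrightarrow> (x - Re v)\<^sup>2 + (exp t / real (Suc n) + Im v)\<^sup>2 \<le> 2 * Im v * exp t"
    for v n x t
  have Q: "Complex x (exp t / real (Suc n)) \<in> hball v (real (Suc n)) \<longleftrightarrow> Q v n x t"
    if "v \<in> upper_half_plane" for v n x t
  proof -
    have "2 * r * Im v * (exp t / r) = 2 * Im v * exp t" if "r > 0" for r :: real
      using that by simp
    from this[of "real (Suc n)"] show ?thesis
      using that by (subst mem_hball_iff)
        (auto simp: Q_def upper_half_plane_def simp del: of_nat_Suc)
  qed
  have mono: "Q v n x t \<Longrightarrow> n \<le> m \<Longrightarrow> Q v m x t" if "v \<in> upper_half_plane" for v n m x t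
  proof -
    assume *: "Q v n x t" "n \<le> m"
    have "exp t / real (Suc m) \<le> exp t / real (Suc n)"
      using * by (intro divide_left_mono) auto
    then have "(exp t / real (Suc m) + Im v)\<^sup>2 \<le> (exp t / real (Suc n) + Im v)\<^sup>2"
      using that by (intro power_mono) (auto simp: upper_half_plane_def intro!: add_nonneg_nonneg)
    with * show ?thesis unfolding Q_def by linarith
  qed
  \<comment> \<open>The inequality on the right is strict because the term
    \<open>exp t / real (Suc n)\<close> in \<open>Q\<close> is positive for every \<open>n\<close>
    and vanishes only in the limit.\<close>
  have lim: "(\<exists>n. Q v n x t) \<longleftrightarrow> exp (- t) < poisson v x" if "v \<in> upper_half_plane" for v x t
  proof -
    have pos: "Im v > 0" using that by (simp add: upper_half_plane_def)
    have "exp (- t) < poisson v x \<longleftrightarrow> (x - Re v)\<^sup>2 + (Im v)\<^sup>2 < 2 * Im v * exp t"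
    proof -
      have "(x - Re v)\<^sup>2 + (Im v)\<^sup>2 > 0" using pos by (intro add_nonneg_pos) auto
      then show ?thesis by (simp add: poisson_def exp_minus field_simps)
    qed
    moreover have "(x - Re v)\<^sup>2 + (Im v)\<^sup>2 < 2 * Im v * exp t" if "Q v n x t" for n
    proof -
      have "(Im v)\<^sup>2 < (exp t / real (Suc n) + Im v)\<^sup>2"
        using pos by (intro power_strict_mono) auto
      with that show ?thesis unfolding Q_def by linarith
    qed
    moreover have "\<exists>n. Q v n x t" if less: "(x - Re v)\<^sup>2 + (Im v)\<^sup>2 < 2 * Im v * exp t"
    proof -
      have "(\<lambda>n. (x - Re v)\<^sup>2 + (exp t * (1 / real (Suc n)) + Im v)\<^sup>2)
          \<longlonglongrightarrow> (x - Re v)\<^sup>2 + (exp t * 0 + Im v)\<^sup>2"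
        by (intro tendsto_intros LIMSEQ_Suc[OF lim_1_over_n])
      then have "\<forall>\<^sub>F n in sequentially. (x - Re v)\<^sup>2 + (exp t * (1 / real (Suc n)) + Im v)\<^sup>2 < 2 * Im v * exp t"
        by (rule order_tendstoD) (use less in simp)
      then have "\<exists>n. (x - Re v)\<^sup>2 + (exp t * (1 / real (Suc n)) + Im v)\<^sup>2 < 2 * Im v * exp t"
        by (rule eventually_happens'[OF sequentially_bot])
      then show ?thesis unfolding Q_def by (auto intro: less_imp_le)
    qed
    ultimately show ?thesis by blast
  qed
  have S: "S n \<in> sets (lborel \<Otimes>\<^sub>M lborel)" for n
    unfolding S_def using z w by (intro emeasure_hyp_area) auto
  have "incseq S"
    using mono[OF z] mono[OF w] by (auto simp: incseq_def S_def Q z w simp del: of_nat_Suc)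
  then have "(\<lambda>n. emeasure horo_measure (S n)) \<longlonglongrightarrow> emeasure horo_measure (\<Union>n. S n)"
    using S by (intro Lim_emeasure_incseq) auto
  also have "emeasure horo_measure (\<Union>n. S n) = overlap z w"
  proof -
    define m where "m x = min (poisson z x) (poisson w x)" for x
    have m: "m x > 0" for x using poisson_pos z w by (simp add: m_def)
    have "(x, t) \<in> (\<Union>n. S n) \<longleftrightarrow> - ln (m x) < t" for x t
    proof -
      have "(x, t) \<in> (\<Union>n. S n) \<longleftrightarrow> (\<exists>n. Q z n x t \<and> Q w n x t)"
        by (simp add: S_def Q z w del: of_nat_Suc)
      \<comment> \<open>By monotonicity the larger of two separate indices serves both
        discs.\<close>
      also have "\<dots> \<longleftrightarrow> (\<exists>n. Q z n x t) \<and> (\<exists>n. Q w n x t)"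
        using mono[OF z] mono[OF w] by (metis nle_le)
      also have "\<dots> \<longleftrightarrow> exp (- t) < m x"
        by (simp add: lim z w m_def)
      also have "\<dots> \<longleftrightarrow> - t < ln (m x)"
        using m by (metis exp_less_cancel_iff exp_ln)
      finally show ?thesis by linarith
    qed
    then have "indicator (\<Union>n. S n) (x, t) = (indicator {- ln (m x)<..} t :: ennreal)" for x t
      by (auto simp: indicator_def)
    then show ?thesis
      using S m by (subst emeasure_horo_measure)
        (auto simp: nn_integral_exp_minus_Ioi overlap_def m_def[symmetric])
  qed
  also have "(\<lambda>n. emeasure horo_measure (S n)) = (\<lambda>n. ennreal (1 / real (Suc n)) *
      emeasure hyp_area (hball z (real (Suc n)) \<inter> hball w (real (Suc n))))"
  proof
    fix n
    have "emeasure hyp_area (hball z (real (Suc n)) \<inter> hball w (real (Suc n))) =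
        ennreal (real (Suc n)) * emeasure horo_measure (S n)"
      unfolding S_def using z w by (intro emeasure_hyp_area) auto
    then show "emeasure horo_measure (S n) = ennreal (1 / real (Suc n)) *
      emeasure hyp_area (hball z (real (Suc n)) \<inter> hball w (real (Suc n)))"
      by (simp add: ennreal_mult[symmetric] flip: mult.assoc del: of_nat_Suc)
  qed
  finally show ?thesis .
qed

text \<open>The invariance is inherited from the areas of the discs through the limit. A direct
  argument would have to transform the Poisson kernels on the boundary, where a Moebius map can send
  a point to infinity.\<close>

lemma overlap_mat_action:
  assumes A: "det A = 1" and z: "z \<in> upper_half_plane" and w: "w \<in> upper_half_plane"
  shows "overlap (mat_action A z) (mat_action A w) = overlap z w"
proof -
  define B where "B v M = hball (mat_action A v) M" for v M
  have B: "B v M \<in> sets hyp_area" if "v \<in> upper_half_plane" for v M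
    unfolding B_def by (intro hball_sets mat_action_upper_half_plane A that)
  have "emeasure hyp_area (B z M \<inter> B w M) = emeasure hyp_area (hball z M \<inter> hball w M)" for M
  proof -
    have "emeasure hyp_area (B z M \<inter> B w M) = (\<integral>\<^sup>+p. indicator (B z M \<inter> B w M) p \<partial>hyp_area)"
      using B z w by auto
    also have "\<dots> = (\<integral>\<^sup>+p. indicator (B z M \<inter> B w M) (mat_action A p) \<partial>hyp_area)"
      using B z w by (intro nn_integral_hyp_area_mat_action[symmetric] A) auto
    also have "\<dots> = (\<integral>\<^sup>+p. indicator (hball z M \<inter> hball w M) p \<partial>hyp_area)"
      by (intro nn_integral_cong) (simp add: indicator_def B_def mat_action_mem_hball_iff A z w)
    also have "\<dots> = emeasure hyp_area (hball z M \<inter> hball w M)"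
      using z w by auto
    finally show ?thesis .
  qed
  then show ?thesis
    using emeasure_hball_tendsto_overlap[OF mat_action_upper_half_plane[OF A z] mat_action_upper_half_plane[OF A w]]
      LIMSEQ_unique[OF emeasure_hball_tendsto_overlap[OF z w]]
    by (simp add: B_def)
qed

section \<open>Closed form of the overlap of two Poisson kernels\<close>

lemma arccos_sin:
  assumes "- (pi / 2) \<le> u" "u \<le> pi / 2"
  shows "arccos (sin u) = pi / 2 - u"
proof -
  have "sin u = cos (pi / 2 - u)" by (simp add: cos_diff)
  then show ?thesis using assms by (simp add: arccos_cos)
qed

text \<open>\<open>arctan (sinh x)\<close> is the Gudermannian of \<open>x\<close>: since
  \<open>sin (arctan s)\<close> is s / sqrt (1 + s^2), its sine is sinh x / cosh x.\<close>

lemma arccos_tanh: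
  fixes x :: real
  shows "arccos (tanh x) = pi / 2 - arctan (sinh x)"
proof -
  have "tanh x = sin (arctan (sinh x))"
    by (simp add: tanh_def sin_arctan cosh_square_eq[symmetric] add.commute[of 1])
  then show ?thesis
    using arctan_bounded[of "sinh x"] by (simp add: arccos_sin)
qed

lemma nn_integral_even:
  fixes f :: "real \<Rightarrow> ennreal"
  assumes [measurable]: "f \<in> borel_measurable borel" and even: "\<And>x. f (- x) = f x"
  shows "(\<integral>\<^sup>+x. f x \<partial>lborel) = 2 * (\<integral>\<^sup>+x. f x * indicator {0..} x \<partial>lborel)"
proof -
  have "(\<integral>\<^sup>+x. f x \<partial>lborel) =
      (\<integral>\<^sup>+x. f x * indicator {0..} x + f x * indicator {..0} x \<partial>lborel)"
    using AE_lborel_singleton[of "0::real"]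
    by (intro nn_integral_cong_AE) (auto elim!: eventually_mono simp: indicator_def)
  also have "\<dots> = (\<integral>\<^sup>+x. f x * indicator {0..} x \<partial>lborel) + (\<integral>\<^sup>+x. f x * indicator {..0} x \<partial>lborel)"
    by (rule nn_integral_add) measurable
  also have "(\<integral>\<^sup>+x. f x * indicator {..0} x \<partial>lborel) =
      ennreal \<bar>- 1\<bar> * (\<integral>\<^sup>+x. f (0 + (- 1) * x) * indicator {..0} (0 + (- 1) * x) \<partial>lborel)"
    by (rule nn_integral_real_affine) auto
  also have "\<dots> = (\<integral>\<^sup>+x. f x * indicator {0..} x \<partial>lborel)"
    by (simp add: even indicator_def)
  finally show ?thesis by (simp add: mult_2)
qed

lemma nn_integral_poisson_tail:
  assumes b: "b > 0"
  shows "(\<integral>\<^sup>+x. ennreal (2 * b / ((x + a)\<^sup>2 + b\<^sup>2)) * indicator {0..} x \<partial>lborel) =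
    ennreal (2 * (pi / 2 - arctan (a / b)))"
proof -
  have "(\<integral>\<^sup>+x. ennreal (2 * b / ((x + a)\<^sup>2 + b\<^sup>2)) * indicator {0..} x \<partial>lborel) =
     ennreal (pi - 2 * arctan ((0 + a) / b))"
  proof (rule nn_integral_FTC_atLeast)
    fix x :: real
    have "b\<^sup>2 + (x + a)\<^sup>2 > 0" using b by (intro add_pos_nonneg) auto
    then show "((\<lambda>x. 2 * arctan ((x + a) / b)) has_real_derivative 2 * b / ((x + a)\<^sup>2 + b\<^sup>2)) (at x)"
      using b by (auto intro!: derivative_eq_intros simp: field_simps power2_eq_square)
    show "0 \<le> 2 * b / ((x + a)\<^sup>2 + b\<^sup>2)" using b by simp
  next
    have "filterlim (\<lambda>x. (x + a) / b) at_top at_top"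
      using filterlim_tendsto_pos_mult_at_top[OF tendsto_const[of "1 / b"] _
          filterlim_tendsto_add_at_top[OF tendsto_const[of a] filterlim_ident]] b
      by (simp add: add.commute)
    from tendsto_mult[OF tendsto_const[of 2] filterlim_compose[OF tendsto_arctan_at_top this]]
    show "((\<lambda>x. 2 * arctan ((x + a) / b)) \<longlongrightarrow> pi) at_top" by simp
  qed measurable
  then show ?thesis by simp
qed

text \<open>At equal height the two kernels are translates of one even function that decreases away
  from its centre. The minimum belongs to the farther centre, so at distance |x| from the midpoint
  it is that function at |x| + a, with a half the Euclidean distance. The integral is twice a tail,
  which an arctangent evaluates.\<close>

lemma overlap_same_height:
  assumes z: "z \<in> upper_half_plane" and w: "w \<in> upper_half_plane" and eq: "Im z = Im w"
  shows "overlap z w = ennreal (4 * arccos (tanh (hyp_dist z w / 2)))"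
proof -
  define b m a where "b = Im z" "m = (Re z + Re w) / 2" "a = \<bar>Re z - Re w\<bar> / 2"
  have b: "b > 0" "b = Im w" using z eq by (auto simp: b_m_a_def upper_half_plane_def)
  have pointwise: "min (poisson z (m + 1 * x)) (poisson w (m + 1 * x)) =
      2 * b / ((\<bar>x\<bar> + a)\<^sup>2 + b\<^sup>2)" for x
  proof -
    define q where "q s = 2 * b / (s\<^sup>2 + b\<^sup>2)" for s
    have q_mono: "q t \<le> q s" if "\<bar>s\<bar> \<le> \<bar>t\<bar>" for s t
      using b that unfolding q_def
      by (intro divide_left_mono mult_pos_pos add_nonneg_pos add_right_mono) (auto simp: abs_le_square_iff)
    have q_abs: "q \<bar>s\<bar> = q s" for s by (simp add: q_def)
    have min_q: "min (q s) (q t) = q (max \<bar>s\<bar> \<bar>t\<bar>)" for s t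
      using q_mono[of s t] q_mono[of t s] by (auto simp: max_def min_def q_abs antisym)
    have "poisson z (m + 1 * x) = q (m + x - Re z)" "poisson w (m + 1 * x) = q (m + x - Re w)"
      using b by (simp_all add: poisson_def q_def b_m_a_def)
    moreover have "max \<bar>m + x - Re z\<bar> \<bar>m + x - Re w\<bar> = \<bar>x\<bar> + a"
    proof -
      define e where "e = (Re w - Re z) / 2"
      have "m + x - Re z = x + e" "m + x - Re w = x - e" "a = \<bar>e\<bar>"
        by (simp_all add: b_m_a_def e_def field_simps)
      then show ?thesis by simp
    qed
    ultimately show ?thesis by (simp add: min_q) (simp add: q_def)
  qed
  have "overlap z w = ennreal \<bar>1\<bar> * (\<integral>\<^sup>+x. ennreal (min (poisson z (m + 1 * x)) (poisson w (m + 1 * x))) \<partial>lborel)"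
    unfolding overlap_def by (rule nn_integral_real_affine) auto
  also have "\<dots> = (\<integral>\<^sup>+x. ennreal (2 * b / ((\<bar>x\<bar> + a)\<^sup>2 + b\<^sup>2)) \<partial>lborel)"
    by (simp only: pointwise) simp
  also have "\<dots> = 2 * (\<integral>\<^sup>+x. ennreal (2 * b / ((\<bar>x\<bar> + a)\<^sup>2 + b\<^sup>2)) * indicator {0..} x \<partial>lborel)"
    by (rule nn_integral_even) auto
  also have "\<dots> = 2 * (\<integral>\<^sup>+x. ennreal (2 * b / ((x + a)\<^sup>2 + b\<^sup>2)) * indicator {0..} x \<partial>lborel)"
    by (intro arg_cong[where f = "\<lambda>s. 2 * s"] nn_integral_cong) (auto simp: indicator_def)
  also have "\<dots> = ennreal (4 * (pi / 2 - arctan (a / b)))"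
    using arctan_ubound[of "a / b"]
    by (subst nn_integral_poisson_tail[OF b(1)])
       (simp add: ennreal_mult[symmetric] flip: ennreal_numeral)
  \<comment> \<open>The duplication formula for cosh turns the formula for
    \<open>cosh (hyp_dist z w)\<close> into one for the half distance.\<close>
  also have "a / b = sinh (hyp_dist z w / 2)"
  proof (rule power2_eq_imp_eq)
    define d where "d = hyp_dist z w / 2"
    have "cosh (2 * d) = 1 + (2 * a)\<^sup>2 / (2 * b * b)"
      using cosh_hyp_dist[OF z w] b eq by (simp add: d_def b_m_a_def cmod_power2)
    moreover have "cosh (2 * d) = 1 + 2 * (sinh d)\<^sup>2"
      by (simp add: cosh_double_cosh cosh_square_eq)
    ultimately have "(sinh d)\<^sup>2 = (2 * a)\<^sup>2 / (2 * b * b) / 2" by simp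
    then show "(a / b)\<^sup>2 = (sinh (hyp_dist z w / 2))\<^sup>2"
      by (simp add: d_def power2_eq_square)
  qed (use b hyp_dist_nonneg[OF z w] in \<open>auto simp: b_m_a_def\<close>)
  finally show ?thesis by (simp add: arccos_tanh)
qed

text \<open>The map p \<mapsto> -1 / (p + s) divides Im p by the squared modulus of p + s, so equal
  heights amount to the quadratic equation \<open>F s = 0\<close>. Geometrically, -s is the centre
  of a horocycle through both points, and this centre is sent to infinity.\<close>

lemma exists_same_height:
  assumes z: "z \<in> upper_half_plane" and w: "w \<in> upper_half_plane" and less: "Im z < Im w"
  obtains A where "det A = 1" "Im (mat_action A z) = Im (mat_action A w)"
proof -
  have pos: "Im z > 0" "Im w > 0" using z w by (auto simp: upper_half_plane_def)
  define F where "F s = ((Re z + s)\<^sup>2 + (Im z)\<^sup>2) * Im w - ((Re w + s)\<^sup>2 + (Im w)\<^sup>2) * Im z" for s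
  have "\<exists>s. F s = 0"
  proof -
    define u v where "u = Re w - Re z" "v = Im w - Im z"
    \<comment> \<open>\<open>F\<close> is the quadratic polynomial \<open>v r\<^sup>2 - 2 u Im z r + c\<close> in \<open>r = Re z + s\<close>,
      with \<open>v > 0\<close> and \<open>c < 0\<close>.\<close>
    define c where "c = Im z * Im z * Im w - (u\<^sup>2 + (Im w)\<^sup>2) * Im z"
    have v: "v > 0" using less by (simp add: u_v_def)
    have "Im z * Im w < (Im w)\<^sup>2" using less pos by (simp add: power2_eq_square)
    then have "Im z * Im w < u\<^sup>2 + (Im w)\<^sup>2" using zero_le_power2[of u] by linarith
    then have "Im z * (Im z * Im w) < Im z * (u\<^sup>2 + (Im w)\<^sup>2)" using pos by simp
    then have c: "c < 0" by (simp add: c_def mult_ac)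
    define D where "D = (u * Im z)\<^sup>2 - v * c"
    have "v * c \<le> 0" using c v by (simp add: mult_nonneg_nonpos)
    then have D: "D \<ge> 0" using zero_le_power2[of "u * Im z"] unfolding D_def by linarith
    define r where "r = (u * Im z + sqrt D) / v"
    have "v * r - u * Im z = sqrt D" using v by (simp add: r_def)
    then have "(v * r - u * Im z)\<^sup>2 = D" using D by simp
    then have "v * (v * r\<^sup>2 - 2 * u * Im z * r + c) = 0"
      by (simp add: D_def power2_eq_square algebra_simps)
    then have "v * r\<^sup>2 - 2 * u * Im z * r + c = 0" using v by simp
    moreover have "F (r - Re z) = v * r\<^sup>2 - 2 * u * Im z * r + c"
      by (simp add: F_def u_v_def c_def power2_eq_square algebra_simps)
    ultimately show ?thesis by auto
  qed
  then obtain s where s: "F s = 0" by blast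
  define A :: "real^2^2" where "A = vector [vector [0, - 1], vector [1, s]]"
  have A: "det A = 1" by (simp add: A_def det_2)
  have "Im (mat_action A p) = Im p / ((Re p + s)\<^sup>2 + (Im p)\<^sup>2)" for p
    by (simp add: Im_mat_action[OF A]) (simp add: A_def cmod_power2)
  moreover have "(Re z + s)\<^sup>2 + (Im z)\<^sup>2 > 0" "(Re w + s)\<^sup>2 + (Im w)\<^sup>2 > 0"
    using pos by (auto intro!: add_nonneg_pos)
  ultimately have "Im (mat_action A z) = Im (mat_action A w)"
    using s pos by (simp add: F_def field_simps)
  with A that show ?thesis by blast
qed

lemma overlap_commute: "overlap z w = overlap w z"
  by (simp add: overlap_def min.commute)

lemma hyp_dist_commute: "hyp_dist z w = hyp_dist w z"
  by (simp add: hyp_dist_def norm_minus_commute mult_ac)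

theorem overlap_eq:
  assumes z: "z \<in> upper_half_plane" and w: "w \<in> upper_half_plane"
  shows "overlap z w = ennreal (4 * arccos (tanh (hyp_dist z w / 2)))"
proof -
  have *: "overlap z w = ennreal (4 * arccos (tanh (hyp_dist z w / 2)))"
    if zw: "z \<in> upper_half_plane" "w \<in> upper_half_plane" "Im z < Im w" for z w
  proof -
    obtain A where A: "det A = 1" "Im (mat_action A z) = Im (mat_action A w)"
      by (rule exists_same_height[OF zw])
    have "overlap z w = overlap (mat_action A z) (mat_action A w)"
      using overlap_mat_action A zw by simp
    also have "\<dots> = ennreal (4 * arccos (tanh (hyp_dist (mat_action A z) (mat_action A w) / 2)))"
      by (intro overlap_same_height mat_action_upper_half_plane A zw)
    finally show ?thesis using hyp_dist_mat_action A zw by simp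
  qed
  show ?thesis
    using *[OF z w] *[OF w z] overlap_same_height[OF z w]
    by (cases "Im z" "Im w" rule: linorder_cases) (auto simp: overlap_commute hyp_dist_commute)
qed

section \<open>Measure-preserving actions of free groups\<close>

text \<open>Sums over the group are written as integrals against counting measure; countability is
  what keeps them measurable in the point.\<close>

lemma borel_measurable_nn_integral_count_space:
  fixes f :: "'i \<Rightarrow> 'a \<Rightarrow> ennreal"
  assumes "countable I" "\<And>i. i \<in> I \<Longrightarrow> f i \<in> borel_measurable M"
  shows "(\<lambda>x. \<integral>\<^sup>+i. f i x \<partial>count_space I) \<in> borel_measurable M"
proof -
  interpret sigma_finite_measure "count_space I"
    by (rule sigma_finite_measure_count_space_countable) fact
  have "(\<lambda>(i, x). f i x) \<in> borel_measurable (count_space I \<Otimes>\<^sub>M M)"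
    using assms by (intro measurable_pair_measure_countable1) auto
  then have "(\<lambda>(x, i). f i x) \<in> borel_measurable (M \<Otimes>\<^sub>M count_space I)"
    by (subst (asm) measurable_pair_swap_iff) (simp add: case_prod_unfold)
  then show ?thesis by (rule borel_measurable_nn_integral)
qed

section \<open>Letters, reduced words and first-letter cylinders\<close>

definition letter_value :: "('a, 'b) monoid_scheme \<Rightarrow> 'a \<times> bool \<Rightarrow> 'a" where
  "letter_value G x = (if snd x then fst x else inv\<^bsub>G\<^esub> (fst x))"

definition opposite :: "'a \<times> bool \<Rightarrow> 'a \<times> bool" where
  "opposite x = (fst x, \<not> snd x)"

lemma opposite_opposite [simp]: "opposite (opposite x) = x"
  by (simp add: opposite_def)

lemma word_value_Nil [simp]: "word_value G [] = \<one>\<^bsub>G\<^esub>"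
  by (simp add: word_value_def)

lemma word_value_Cons [simp]:
  "word_value G (x # w) = letter_value G x \<otimes>\<^bsub>G\<^esub> word_value G w"
  by (simp add: word_value_def letter_value_def case_prod_unfold)

lemma Nil_reduced_words [simp]: "[] \<in> reduced_words S"
  by (simp add: reduced_words_def)

lemma Cons_reduced_words_iff:
  "x # w \<in> reduced_words S \<longleftrightarrow>
    fst x \<in> S \<and> w \<in> reduced_words S \<and> (w \<noteq> [] \<longrightarrow> hd w \<noteq> opposite x)"
  by (cases x; cases w) (auto simp: reduced_words_def opposite_def prod_eq_iff)

definition words_from :: "'a set \<Rightarrow> 'a \<times> bool \<Rightarrow> ('a \<times> bool) list set" where
  "words_from S x = {w \<in> reduced_words S. w \<noteq> [] \<and> hd w = x}"

context group
begin

lemma letter_value_closed: "fst x \<in> carrier G \<Longrightarrow> letter_value G x \<in> carrier G"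
  by (simp add: letter_value_def)

lemma letter_value_opposite:
  "fst x \<in> carrier G \<Longrightarrow> letter_value G (opposite x) = inv (letter_value G x)"
  by (simp add: letter_value_def opposite_def)

lemma word_value_closed:
  assumes "S \<subseteq> carrier G" "w \<in> reduced_words S"
  shows "word_value G w \<in> carrier G"
  using assms(2)
proof (induction w)
  case (Cons x w)
  with assms(1) show ?case
    by (auto simp: Cons_reduced_words_iff intro!: m_closed letter_value_closed)
qed simp

lemma countable_freely_generated:
  assumes "freely_generated G S" "finite S"
  shows "countable (carrier G)"
proof -
  have "reduced_words S \<subseteq> lists (S \<times> UNIV)"
    by (auto simp: reduced_words_def in_lists_conv_set mem_Times_iff)
  moreover have "countable (lists (S \<times> (UNIV :: bool set)))"
    using assms(2) by (intro countable_lists countable_finite) auto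
  ultimately have "countable (reduced_words S)"
    by (rule countable_subset)
  then show ?thesis
    using assms(1) by (metis bij_betw_imp_surj_on countable_image freely_generated_def)
qed

definition cylinder :: "'a set \<Rightarrow> 'a \<times> bool \<Rightarrow> 'a set" where
  "cylinder S x = word_value G ` words_from S x"

lemma cylinder_subset:
  assumes "freely_generated G S"
  shows "cylinder S x \<subseteq> carrier G"
  using assms word_value_closed
  by (auto simp: cylinder_def words_from_def freely_generated_def)

lemma disjoint_cylinders:
  assumes "freely_generated G S"
  shows "disjoint_family_on (cylinder S) A"
proof -
  have inj: "inj_on (word_value G) (reduced_words S)"
    using assms by (auto simp: freely_generated_def bij_betw_def)
  show ?thesis
    using inj_onD[OF inj] by (force simp: disjoint_family_on_def cylinder_def words_from_def)
qed

text \<open>Multiplication by the inverse of a letter carries the elements beginning with this letter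
  to those that do not begin with the inverse letter; this is the paradoxical decomposition
  of a free group.\<close>

lemma bij_betw_cylinder:
  assumes free: "freely_generated G S" and x: "fst x \<in> S"
  shows "bij_betw (\<lambda>\<gamma>. letter_value G x \<otimes> \<gamma>) (carrier G - cylinder S (opposite x)) (cylinder S x)"
proof -
  have S: "S \<subseteq> carrier G" and bij: "bij_betw (word_value G) (reduced_words S) (carrier G)"
    using free by (auto simp: freely_generated_def)
  have "carrier G - cylinder S (opposite x) =
      word_value G ` (reduced_words S - words_from S (opposite x))"
    unfolding cylinder_def using bij
    by (subst inj_on_image_set_diff[of _ "reduced_words S"])
       (auto simp: bij_betw_def words_from_def)
  moreover have "bij_betw (word_value G) (reduced_words S - words_from S (opposite x))
      (word_value G ` (reduced_words S - words_from S (opposite x)))"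
    using bij by (auto simp: bij_betw_def intro: inj_on_subset)
  moreover have "words_from S x = (#) x ` (reduced_words S - words_from S (opposite x))"
  proof -
    have "w \<in> words_from S x \<longleftrightarrow> w \<in> (#) x ` (reduced_words S - words_from S (opposite x))" for w
      using x by (cases w) (auto simp: words_from_def Cons_reduced_words_iff)
    then show ?thesis by blast
  qed
  ultimately show ?thesis
    unfolding cylinder_def bij_betw_def using S x
    by (auto simp: image_image inj_on_def letter_value_closed word_value_closed subset_iff)
qed

text \<open>The pair consisting of \<open>s\<close> and its inverse pays for one overlap, and the
  first-letter weights of all letters at a point add up to at most one. So all overlaps together
  cost a single integral of \<open>u\<close>, which will be the indicator of a disc.\<close>

theorem free_action_overlap_inequality:
  fixes M :: "'x measure" and act :: "'a \<Rightarrow> 'x \<Rightarrow> 'x" and u \<phi> :: "'x \<Rightarrow> ennreal"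
  assumes free: "freely_generated G S" and fin: "finite S"
    and act: "\<And>\<gamma>. \<gamma> \<in> carrier G \<Longrightarrow> act \<gamma> \<in> M \<rightarrow>\<^sub>M M"
    and act_one: "\<And>p. p \<in> space M \<Longrightarrow> act \<one> p = p"
    and act_mult: "\<And>\<gamma> \<delta> p. \<gamma> \<in> carrier G \<Longrightarrow> \<delta> \<in> carrier G \<Longrightarrow> p \<in> space M \<Longrightarrow>
      act (\<gamma> \<otimes> \<delta>) p = act \<gamma> (act \<delta> p)"
    and invariant: "\<And>\<gamma> f. \<gamma> \<in> carrier G \<Longrightarrow> f \<in> borel_measurable M \<Longrightarrow>
      (\<integral>\<^sup>+p. f (act \<gamma> p) \<partial>M) = (\<integral>\<^sup>+p. f p \<partial>M)"
    and \<phi>: "\<phi> \<in> borel_measurable M"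
    and \<phi>_sum: "\<And>p. p \<in> space M \<Longrightarrow> (\<integral>\<^sup>+\<gamma>. \<phi> (act \<gamma> p) \<partial>count_space (carrier G)) = 1"
    and u: "u \<in> borel_measurable M"
  shows "(\<Sum>s\<in>S. \<integral>\<^sup>+p. min (u p) (u (act (inv s) p)) \<partial>M) \<le> (\<integral>\<^sup>+p. u p \<partial>M)"
proof -
  have S: "S \<subseteq> carrier G" using free by (simp add: freely_generated_def)
  note count = countable_freely_generated[OF free fin]
  have space: "act \<gamma> p \<in> space M" if "\<gamma> \<in> carrier G" "p \<in> space M" for \<gamma> p
    using measurable_space[OF act] that by blast
  have \<phi>_inv: "(\<integral>\<^sup>+\<gamma>. \<phi> (act (inv \<gamma>) p) \<partial>count_space (carrier G)) = 1" if "p \<in> space M" for p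
  proof -
    have "bij_betw (\<lambda>\<gamma>. inv \<gamma>) (carrier G) (carrier G)"
      by (rule bij_betw_byWitness[where f' = "\<lambda>\<gamma>. inv \<gamma>"]) auto
    from nn_integral_bij_count_space[OF this, of "\<lambda>\<gamma>. \<phi> (act \<gamma> p)"] show ?thesis
      using \<phi>_sum[OF that] by simp
  qed
  \<comment> \<open>The inverse appears because a point lies in the image of a fundamental domain
    under \<gamma> exactly when the inverse of \<gamma> moves it into the domain.\<close>
  define f where "f x p = (\<integral>\<^sup>+\<gamma>. \<phi> (act (inv \<gamma>) p) \<partial>count_space (cylinder S x))" for x p
  have f [measurable]: "f x \<in> borel_measurable M" for x
    unfolding f_def using cylinder_subset[OF free, of x] count
    by (intro borel_measurable_nn_integral_count_space measurable_compose[OF act \<phi>])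
       (auto intro: countable_subset)
  have f_shift: "f x (act (letter_value G x) p) + f (opposite x) p = 1"
    if x: "fst x \<in> S" and p: "p \<in> space M" for x p
  proof -
    have l: "letter_value G x \<in> carrier G" using x S by (auto intro: letter_value_closed)
    have "f x (act (letter_value G x) p) =
        (\<integral>\<^sup>+\<delta>. \<phi> (act (inv (letter_value G x \<otimes> \<delta>)) (act (letter_value G x) p))
          \<partial>count_space (carrier G - cylinder S (opposite x)))"
      unfolding f_def by (rule nn_integral_bij_count_space[OF bij_betw_cylinder[OF free x], symmetric])
    also have "\<dots> = (\<integral>\<^sup>+\<delta>. \<phi> (act (inv \<delta>) p) \<partial>count_space (carrier G - cylinder S (opposite x)))"
    proof (rule nn_integral_cong)
      fix \<delta> assume "\<delta> \<in> space (count_space (carrier G - cylinder S (opposite x)))"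
      then have "\<delta> \<in> carrier G" by simp
      then have "act (inv (letter_value G x \<otimes> \<delta>)) (act (letter_value G x) p) = act (inv \<delta>) p"
        using l p by (simp add: act_mult[symmetric] inv_mult_group m_assoc)
      then show "\<phi> (act (inv (letter_value G x \<otimes> \<delta>)) (act (letter_value G x) p)) = \<phi> (act (inv \<delta>) p)"
        by simp
    qed
    also have "\<dots> + f (opposite x) p = (\<integral>\<^sup>+\<delta>. \<phi> (act (inv \<delta>) p) \<partial>count_space (carrier G))"
      unfolding f_def using cylinder_subset[OF free, of "opposite x"]
      by (subst (1 2 3) nn_integral_count_space_indicator, simp_all add: NO_MATCH_def flip: nn_integral_add)
         (intro nn_integral_cong, auto simp: indicator_def)
    finally show ?thesis using \<phi>_inv[OF p] by simp
  qed
  \<comment> \<open>Only an inequality: the identity is the value of the empty word and lies in no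
    cylinder.\<close>
  have f_sum: "(\<Sum>s\<in>S. f (s, True) p + f (s, False) p) \<le> 1" if p: "p \<in> space M" for p
  proof -
    have "(\<Sum>s\<in>S. f (s, True) p + f (s, False) p) = (\<Sum>s\<in>S. \<Sum>e\<in>UNIV. f (s, e) p)"
      by (simp add: UNIV_bool add.commute)
    also have "\<dots> = (\<Sum>x\<in>S \<times> UNIV. f x p)"
      by (simp add: sum.cartesian_product)
    also have "\<dots> = (\<integral>\<^sup>+\<gamma>. \<phi> (act (inv \<gamma>) p) * (\<Sum>x\<in>S \<times> UNIV. indicator (cylinder S x) \<gamma>) \<partial>count_space UNIV)"
      unfolding f_def using fin
      by (subst nn_integral_count_space_indicator, simp add: NO_MATCH_def)
         (simp add: sum_distrib_left flip: nn_integral_sum)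
    also have "\<dots> = (\<integral>\<^sup>+\<gamma>. \<phi> (act (inv \<gamma>) p) * indicator (\<Union>x\<in>S \<times> UNIV. cylinder S x) \<gamma> \<partial>count_space UNIV)"
      using fin by (subst indicator_UN_disjoint[OF _ disjoint_cylinders[OF free]]) auto
    also have "\<dots> \<le> (\<integral>\<^sup>+\<gamma>. \<phi> (act (inv \<gamma>) p) * indicator (carrier G) \<gamma> \<partial>count_space UNIV)"
      using cylinder_subset[OF free]
      by (intro nn_integral_mono mult_left_mono) (auto simp: indicator_def)
    also have "\<dots> = 1"
      using \<phi>_inv[OF p] by (subst (asm) nn_integral_count_space_indicator) (simp_all add: NO_MATCH_def)
    finally show ?thesis .
  qed
  have "(\<Sum>s\<in>S. \<integral>\<^sup>+p. min (u p) (u (act (inv s) p)) \<partial>M) \<le>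
      (\<Sum>s\<in>S. \<integral>\<^sup>+p. u p * (f (s, True) p + f (s, False) p) \<partial>M)"
  proof (rule sum_mono)
    fix s assume s: "s \<in> S"
    then have sG: "s \<in> carrier G" using S by auto
    have "(\<integral>\<^sup>+p. min (u p) (u (act (inv s) p)) \<partial>M) \<le>
        (\<integral>\<^sup>+p. u p * f (s, True) p + u (act (inv s) p) * f (s, False) (act (inv s) p) \<partial>M)"
    proof (rule nn_integral_mono)
      fix p assume p: "p \<in> space M"
      define q where "q = act (inv s) p"
      have q: "q \<in> space M" using space p sG by (simp add: q_def)
      have "act s q = p" using act_mult[of s "inv s" p] act_one p sG by (simp add: q_def)
      with f_shift[of "(s, True)" q] s q have "f (s, True) p + f (s, False) q = 1"
        by (simp add: letter_value_def opposite_def)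
      \<comment> \<open>The two weights with sum one split the minimum; each share is then bounded
        by the value of \<open>u\<close> at the point carrying that weight.\<close>
      then have "min (u p) (u q) = min (u p) (u q) * f (s, True) p + min (u p) (u q) * f (s, False) q"
        by (simp flip: distrib_left)
      also have "\<dots> \<le> u p * f (s, True) p + u q * f (s, False) q"
        by (intro add_mono mult_right_mono) auto
      finally show "min (u p) (u (act (inv s) p)) \<le>
          u p * f (s, True) p + u (act (inv s) p) * f (s, False) (act (inv s) p)"
        by (simp add: q_def)
    qed
    also have "\<dots> = (\<integral>\<^sup>+p. u p * f (s, True) p \<partial>M) +
        (\<integral>\<^sup>+p. u (act (inv s) p) * f (s, False) (act (inv s) p) \<partial>M)"
      using u measurable_compose[OF act, of "inv s" "\<lambda>p. u p * f (s, False) p"] sG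
      by (intro nn_integral_add) auto
    \<comment> \<open>Invariance undoes the translation, so that the letters
      \<open>(s, True)\<close> and \<open>(s, False)\<close> end up weighted by the same
      \<open>u p\<close>.\<close>
    also have "(\<integral>\<^sup>+p. u (act (inv s) p) * f (s, False) (act (inv s) p) \<partial>M) =
        (\<integral>\<^sup>+p. u p * f (s, False) p \<partial>M)"
      using sG u by (intro invariant[of "inv s" "\<lambda>p. u p * f (s, False) p"]) auto
    also have "(\<integral>\<^sup>+p. u p * f (s, True) p \<partial>M) + (\<integral>\<^sup>+p. u p * f (s, False) p \<partial>M) =
        (\<integral>\<^sup>+p. u p * (f (s, True) p + f (s, False) p) \<partial>M)"
      using u by (simp add: distrib_left nn_integral_add)
    finally show "(\<integral>\<^sup>+p. min (u p) (u (act (inv s) p)) \<partial>M) \<le>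
        (\<integral>\<^sup>+p. u p * (f (s, True) p + f (s, False) p) \<partial>M)" .
  qed
  also have "\<dots> = (\<integral>\<^sup>+p. u p * (\<Sum>s\<in>S. f (s, True) p + f (s, False) p) \<partial>M)"
    using u by (simp add: sum_distrib_left nn_integral_sum)
  also have "\<dots> \<le> (\<integral>\<^sup>+p. u p * 1 \<partial>M)"
    by (intro nn_integral_mono mult_left_mono f_sum) auto
  finally show ?thesis by simp
qed

text \<open>The function \<open>\<phi>\<close> is the uniform weight on the finitely many points of each orbit that lie in the
  first \<open>K n\<close> met by the orbit. Unlike a fundamental domain, this needs no freeness of the action.\<close>

theorem exists_partition_of_unity:
  fixes M :: "'x measure" and act :: "'a \<Rightarrow> 'x \<Rightarrow> 'x" and K :: "nat \<Rightarrow> 'x set"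
  assumes count: "countable (carrier G)"
    and act: "\<And>\<gamma>. \<gamma> \<in> carrier G \<Longrightarrow> act \<gamma> \<in> M \<rightarrow>\<^sub>M M"
    and act_one: "\<And>p. p \<in> space M \<Longrightarrow> act \<one> p = p"
    and act_mult: "\<And>\<gamma> \<delta> p. \<gamma> \<in> carrier G \<Longrightarrow> \<delta> \<in> carrier G \<Longrightarrow> p \<in> space M \<Longrightarrow>
      act (\<gamma> \<otimes> \<delta>) p = act \<gamma> (act \<delta> p)"
    and K: "\<And>n. K n \<in> sets M" and cover: "space M \<subseteq> (\<Union>n. K n)"
    and fin: "\<And>p n. p \<in> space M \<Longrightarrow> finite {\<gamma> \<in> carrier G. act \<gamma> p \<in> K n}"
  obtains \<phi> :: "'x \<Rightarrow> ennreal" where "\<phi> \<in> borel_measurable M"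
    "\<And>p. p \<in> space M \<Longrightarrow> (\<integral>\<^sup>+\<gamma>. \<phi> (act \<gamma> p) \<partial>count_space (carrier G)) = 1"
proof -
  define P where "P p n \<longleftrightarrow> (\<exists>\<gamma>\<in>carrier G. act \<gamma> p \<in> K n)" for p n
  define lev where "lev p = (LEAST n. P p n)" for p
  define \<psi> :: "'x \<Rightarrow> ennreal" where "\<psi> p = indicator (K (lev p)) p" for p
  define T where "T p = (\<integral>\<^sup>+\<gamma>. \<psi> (act \<gamma> p) \<partial>count_space (carrier G))" for p
  have space: "act \<gamma> p \<in> space M" if "\<gamma> \<in> carrier G" "p \<in> space M" for \<gamma> p
    using measurable_space[OF act] that by blast
  have bij: "bij_betw (\<lambda>\<gamma>. \<gamma> \<otimes> \<delta>) (carrier G) (carrier G)" if "\<delta> \<in> carrier G" for \<delta>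
    using that by (intro bij_betw_byWitness[where f' = "\<lambda>\<gamma>. \<gamma> \<otimes> inv \<delta>"]) (auto simp: m_assoc)
  have P_act: "P (act \<delta> p) n \<longleftrightarrow> P p n" if "\<delta> \<in> carrier G" "p \<in> space M" for \<delta> p n
  proof
    assume "P (act \<delta> p) n"
    then obtain \<gamma> where "\<gamma> \<in> carrier G" "act \<gamma> (act \<delta> p) \<in> K n" by (auto simp: P_def)
    then show "P p n" using that act_mult[of \<gamma> \<delta> p] by (auto simp: P_def intro!: bexI[of _ "\<gamma> \<otimes> \<delta>"])
  next
    assume "P p n"
    then obtain \<gamma> where \<gamma>: "\<gamma> \<in> carrier G" "act \<gamma> p \<in> K n" by (auto simp: P_def)
    then have "act (\<gamma> \<otimes> inv \<delta>) (act \<delta> p) = act \<gamma> p"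
      using that act_mult[of "\<gamma> \<otimes> inv \<delta>" \<delta> p] by (simp add: m_assoc)
    with \<gamma> that show "P (act \<delta> p) n"
      by (auto simp: P_def intro!: bexI[of _ "\<gamma> \<otimes> inv \<delta>"])
  qed
  have lev_act: "lev (act \<delta> p) = lev p" if "\<delta> \<in> carrier G" "p \<in> space M" for \<delta> p
  proof -
    have "P (act \<delta> p) = P p" using P_act[OF that] by blast
    then show ?thesis by (simp add: lev_def)
  qed
  have T_act: "T (act \<delta> p) = T p" if "\<delta> \<in> carrier G" "p \<in> space M" for \<delta> p
  proof -
    have "T (act \<delta> p) = (\<integral>\<^sup>+\<gamma>. \<psi> (act (\<gamma> \<otimes> \<delta>) p) \<partial>count_space (carrier G))"
      unfolding T_def using that by (intro nn_integral_cong) (simp add: act_mult)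
    also have "\<dots> = T p"
      unfolding T_def by (rule nn_integral_bij_count_space[OF bij[OF that(1)]])
    finally show ?thesis .
  qed
  have lev_meas: "lev \<in> measurable M (count_space UNIV)"
    unfolding lev_def
  proof (rule measurable_Least)
    fix n
    have "{p \<in> space M. P p n} = (\<Union>\<gamma>\<in>carrier G. act \<gamma> -` K n \<inter> space M)"
      by (auto simp: P_def)
    also have "\<dots> \<in> sets M"
      using count act K by (intro sets.countable_UN'' measurable_sets) auto
    finally show "(\<lambda>p. P p n) \<in> measurable M (count_space UNIV)"
      by (simp add: pred_def)
  qed
  have \<psi>_meas: "\<psi> \<in> borel_measurable M"
  proof -
    have "{p \<in> space M. p \<in> K (lev p)} = (\<Union>n. (lev -` {n} \<inter> space M) \<inter> K n)" by auto
    also have "\<dots> \<in> sets M"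
      using lev_meas K by (intro sets.countable_UN sets.Int measurable_sets) auto
    finally have "indicator {p \<in> space M. p \<in> K (lev p)} \<in> borel_measurable M" by simp
    then show ?thesis
      by (rule measurable_cong[THEN iffD1, rotated]) (auto simp: \<psi>_def indicator_def)
  qed
  have T_meas: "T \<in> borel_measurable M"
    unfolding T_def[abs_def] using count act \<psi>_meas
    by (intro borel_measurable_nn_integral_count_space measurable_compose[OF act \<psi>_meas])
  \<comment> \<open>\<open>T p\<close> counts group elements rather than points of the orbit, so
    stabilisers merely contribute multiplicity. The count is finite by \<open>fin\<close> and
    nonzero because the least level is attained.\<close>
  have T: "T p \<noteq> 0" "T p \<noteq> \<infinity>" if p: "p \<in> space M" for p
  proof -
    define F where "F = {\<gamma> \<in> carrier G. act \<gamma> p \<in> K (lev p)}"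
    have "T p = (\<integral>\<^sup>+\<gamma>. indicator F \<gamma> \<partial>count_space (carrier G))"
      unfolding T_def using p
      by (intro nn_integral_cong) (auto simp: \<psi>_def F_def indicator_def lev_act)
    also have "\<dots> = emeasure (count_space (carrier G)) F"
      by (rule nn_integral_indicator) (auto simp: F_def)
    also have "\<dots> = of_nat (card F)"
      using fin[OF p] by (intro emeasure_count_space_finite) (auto simp: F_def)
    finally have T_card: "T p = of_nat (card F)" .
    obtain n where "p \<in> K n" using cover p by auto
    then have "P p n" using act_one[OF p] unfolding P_def by (metis one_closed)
    then have "P p (lev p)" unfolding lev_def by (rule LeastI)
    then have "F \<noteq> {}" by (auto simp: P_def F_def)
    with fin[OF p, of "lev p"] have "card F \<noteq> 0" by (simp add: F_def)
    then show "T p \<noteq> 0" "T p \<noteq> \<infinity>" by (simp_all add: T_card)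
  qed
  show ?thesis
  proof (rule that)
    show "(\<lambda>p. \<psi> p / T p) \<in> borel_measurable M"
      using \<psi>_meas T_meas by measurable
    fix p assume p: "p \<in> space M"
    have "(\<integral>\<^sup>+\<gamma>. \<psi> (act \<gamma> p) / T (act \<gamma> p) \<partial>count_space (carrier G)) =
        (\<integral>\<^sup>+\<gamma>. \<psi> (act \<gamma> p) / T p \<partial>count_space (carrier G))"
      by (intro nn_integral_cong) (simp add: T_act p)
    also have "\<dots> = T p / T p"
      unfolding T_def by (rule nn_integral_divide) simp
    also have "\<dots> = 1" using T[OF p] by (simp add: less_top)
    finally show "(\<integral>\<^sup>+\<gamma>. \<psi> (act \<gamma> p) / T (act \<gamma> p) \<partial>count_space (carrier G)) = 1" .
  qed
qed

end

section \<open>Free Fuchsian groups\<close>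

lemma psl_closed: "det A = 1 \<Longrightarrow> psl A \<in> carrier PSL2R"
  by (simp add: carrier_PSL2R SL2R_def)

lemma carrier_PSL2RE:
  assumes "\<gamma> \<in> carrier PSL2R"
  obtains A where "\<gamma> = psl A" "det A = 1"
  using assms by (auto simp: carrier_PSL2R SL2R_def)

lemma psl_mult': "det A = 1 \<Longrightarrow> det B = 1 \<Longrightarrow> psl A \<otimes>\<^bsub>PSL2R\<^esub> psl B = psl (A ** B)"
  by (rule psl_mult) (simp_all add: SL2R_def)

lemma one_PSL2R: "\<one>\<^bsub>PSL2R\<^esub> = psl (mat 1)"
  by (simp add: PSL2R_def FactGroup_def psl_eq)

lemma psl_eq_iff: "psl A = psl B \<longleftrightarrow> A = B \<or> A = - B"
  by (auto simp: psl_eq doubleton_eq_iff minus_equation_iff)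

text \<open>This is the inverse on matrices of determinant one, written as a formula linear in the
  entries: it is visibly continuous and preserves integrality.\<close>

definition adjugate :: "real^2^2 \<Rightarrow> real^2^2" where
  "adjugate A = (\<chi> i j. if i = j then (if i = 1 then A $ 2 $ 2 else A $ 1 $ 1) else - A $ i $ j)"

lemma adjugate_nth [simp]:
  "adjugate A $ 1 $ 1 = A $ 2 $ 2" "adjugate A $ 1 $ 2 = - A $ 1 $ 2"
  "adjugate A $ 2 $ 1 = - A $ 2 $ 1" "adjugate A $ 2 $ 2 = A $ 1 $ 1"
  by (simp_all add: adjugate_def)

lemma matrix_mult_nth: "(A ** B) $ i $ j = A $ i $ 1 * B $ 1 $ j + A $ i $ 2 * B $ 2 $ j"
  for A B :: "real^2^2"
  by (simp add: matrix_matrix_mult_def sum_2)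

lemma matrix_eq_2_iff: "A = B \<longleftrightarrow> A $ 1 $ 1 = B $ 1 $ 1 \<and> A $ 1 $ 2 = B $ 1 $ 2 \<and>
    A $ 2 $ 1 = B $ 2 $ 1 \<and> A $ 2 $ 2 = B $ 2 $ 2"
  for A B :: "real^2^2"
  by (auto simp: vec_eq_iff forall_2)

lemma mat_1_nth [simp]:
  "(mat 1 :: real^2^2) $ 1 $ 1 = 1" "(mat 1 :: real^2^2) $ 1 $ 2 = 0"
  "(mat 1 :: real^2^2) $ 2 $ 1 = 0" "(mat 1 :: real^2^2) $ 2 $ 2 = 1"
  by (simp_all add: mat_def)

lemma adjugate_mult:
  assumes "det A = 1"
  shows "adjugate A ** A = mat 1" "A ** adjugate A = mat 1"
  using assms by (auto simp: matrix_eq_2_iff matrix_mult_nth det_2 algebra_simps)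

lemma det_adjugate: "det (adjugate A) = det A"
  by (simp add: det_2)

lemma inv_psl:
  assumes "det A = 1"
  shows "inv\<^bsub>PSL2R\<^esub> (psl A) = psl (adjugate A)"
  using assms
  by (intro group.inv_equality[OF group_PSL2R])
     (auto simp: psl_mult' psl_closed det_adjugate adjugate_mult one_PSL2R)

lemma mat_action_mult:
  assumes A: "det A = 1" and B: "det B = 1" and p: "p \<in> upper_half_plane"
  shows "mat_action (A ** B) p = mat_action A (mat_action B p)"
proof -
  define q where "q = complex_of_real (B$2$1) * p + of_real (B$2$2)"
  define r where "r = complex_of_real (B$1$1) * p + of_real (B$1$2)"
  have q: "q \<noteq> 0" unfolding q_def by (rule mat_action_denom_nonzero[OF B p])
  have Bp: "mat_action B p = r / q" by (simp add: mat_action_def moebius_def q_def r_def)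
  have "mat_action (A ** B) p = (A$1$1 * r + A$1$2 * q) / (A$2$1 * r + A$2$2 * q)"
    by (simp add: mat_action_def moebius_def matrix_mult_nth q_def r_def algebra_simps)
  also have "\<dots> = (A$1$1 * (r / q) + A$1$2) / (A$2$1 * (r / q) + A$2$2)"
    using q by (simp add: divide_simps)
  finally show ?thesis by (simp add: Bp) (simp add: mat_action_def moebius_def)
qed

lemma mat_action_1: "mat_action (mat 1) p = p"
  by (simp add: mat_action_def moebius_def)

section \<open>The action on the half-plane and proper discontinuity\<close>

lemma psl_action_closed:
  assumes "\<gamma> \<in> carrier PSL2R" "p \<in> upper_half_plane"
  shows "psl_action \<gamma> p \<in> upper_half_plane"
  using assms by (auto elim!: carrier_PSL2RE simp: psl_action_psl mat_action_upper_half_plane)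

lemma psl_action_one: "psl_action \<one>\<^bsub>PSL2R\<^esub> p = p"
  by (simp add: one_PSL2R psl_action_psl mat_action_1)

lemma psl_action_mult:
  assumes "\<gamma> \<in> carrier PSL2R" "\<delta> \<in> carrier PSL2R" "p \<in> upper_half_plane"
  shows "psl_action (\<gamma> \<otimes>\<^bsub>PSL2R\<^esub> \<delta>) p = psl_action \<gamma> (psl_action \<delta> p)"
  using assms by (auto elim!: carrier_PSL2RE simp: psl_mult' psl_action_psl mat_action_mult)

text \<open>Discreteness is used at the identity alone. The open set isolating it in the quotient
  topology is pulled back to matrices, where it contains a ball about \<open>mat 1\<close>.\<close>

lemma fuchsian_separated:
  assumes "fuchsian \<Phi>"
  obtains e where "e > 0" "\<And>A. det A = 1 \<Longrightarrow> psl A \<in> \<Phi> \<Longrightarrow> dist A (mat 1) < e \<Longrightarrow> psl A = psl (mat 1)"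
proof -
  have "psl (mat 1) \<in> \<Phi>"
    using assms subgroup.one_closed[of \<Phi> PSL2R] by (simp add: fuchsian_def one_PSL2R)
  then have "openin (subtopology PSL2R_topology \<Phi>) {psl (mat 1)}"
    using assms by (simp add: fuchsian_def)
  then obtain T where T: "openin PSL2R_topology T" "{psl (mat 1)} = T \<inter> \<Phi>"
    by (auto simp: openin_subtopology)
  have "openin (top_of_set (carrier SL2R)) {x \<in> carrier SL2R. psl x \<in> T}"
    using T(1) by (simp add: PSL2R_topology_def openin_quotient_topology)
  moreover have "mat 1 \<in> {x \<in> carrier SL2R. psl x \<in> T}"
    using T(2) by (auto simp: SL2R_def)
  ultimately obtain e where e: "e > 0"
    "\<forall>A\<in>carrier SL2R. dist A (mat 1) < e \<longrightarrow> A \<in> {x \<in> carrier SL2R. psl x \<in> T}"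
    by (auto simp: openin_euclidean_subtopology_iff)
  show ?thesis
    by (rule that[OF e(1)]) (use e(2) T(2) in \<open>auto simp: SL2R_def\<close>)
qed

text \<open>Continuity at a pair (l, l) transports an accumulation at l to one at the identity,
  where discreteness can be applied.\<close>

lemma isCont_adjugate_mult: "isCont (\<lambda>q. adjugate (fst q) ** snd q) (x :: (real^2^2) \<times> (real^2^2))"
proof -
  have "((\<lambda>q. (adjugate (fst q) ** snd q) $ i $ j) \<longlongrightarrow> (adjugate (fst x) ** snd x) $ i $ j) (at x)"
    for i j
    using exhaust_2[of i] exhaust_2[of j]
    by ((elim disjE; simp add: matrix_mult_nth), (intro tendsto_intros)+)
  then show ?thesis
    unfolding isCont_def by (intro vec_tendstoI)
qed

lemma norm_matrix_le: "norm A \<le> (\<Sum>i\<in>UNIV. \<Sum>j\<in>UNIV. \<bar>A $ i $ j\<bar>)" for A :: "real^2^2"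
proof -
  have "norm A \<le> (\<Sum>i\<in>UNIV. norm (A $ i))"
    unfolding norm_vec_def[of A] by (rule L2_set_le_sum) simp
  also have "\<dots> \<le> (\<Sum>i\<in>UNIV. \<Sum>j\<in>UNIV. \<bar>A $ i $ j\<bar>)"
    by (intro sum_mono norm_le_l1_cart)
  finally show ?thesis .
qed

definition exhaustion :: "nat \<Rightarrow> complex set" where
  "exhaustion n = {w. Im w \<ge> 1 / real (Suc n) \<and> cmod w \<le> real (Suc n)}"

lemma exhaustion_subset: "exhaustion n \<subseteq> upper_half_plane"
  by (auto simp: exhaustion_def upper_half_plane_def intro: less_le_trans[rotated])

lemma exhaustion_covers: "upper_half_plane \<subseteq> (\<Union>n. exhaustion n)"
proof
  fix p assume "p \<in> upper_half_plane"
  then have p: "Im p > 0" by (simp add: upper_half_plane_def)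
  obtain n where n: "max (cmod p) (1 / Im p) < real n" using reals_Archimedean2 by blast
  then have "1 / Im p \<le> real (Suc n)" "cmod p \<le> real (Suc n)" by auto
  moreover from this(1) p have "1 / real (Suc n) \<le> Im p" by (simp add: field_simps)
  ultimately show "p \<in> (\<Union>n. exhaustion n)" by (auto simp: exhaustion_def)
qed

lemma exhaustion_sets: "exhaustion n \<in> sets hyp_area"
proof -
  have "closed (exhaustion n)"
    unfolding exhaustion_def by (intro closed_Collect_conj closed_Collect_le continuous_intros)
  then have "upper_half_plane \<inter> exhaustion n \<in> sets hyp_area"
    by (auto simp: sets_hyp_area sets_restrict_space)
  also have "upper_half_plane \<inter> exhaustion n = exhaustion n" using exhaustion_subset by blast
  finally show ?thesis .
qed

text \<open>The action is proper: a lower bound on the height of the image bounds c p + d, and then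
  a bound on the modulus of the image bounds a p + b. As p is not real, bounds on these linear forms
  give bounds on their real coefficients.\<close>

lemma bounded_mat_action_exhaustion:
  assumes p: "p \<in> upper_half_plane"
  shows "bounded {A. det A = 1 \<and> mat_action A p \<in> exhaustion n}"
proof -
  define y N where "y = Im p" "N = real (Suc n)"
  \<comment> \<open>\<open>sqrt (y * N)\<close> bounds the denominator, and a further factor
    \<open>N\<close> bounds the numerator; \<open>N \<ge> 1\<close> lets \<open>R\<close> serve for
    both.\<close>
  define R where "R = N * sqrt (y * N)"
  have y: "y > 0" using p by (simp add: y_N_def upper_half_plane_def)
  have N: "N \<ge> 1" by (simp add: y_N_def)
  have bound: "\<bar>a\<bar> \<le> R / y" "\<bar>b\<bar> \<le> R + R / y * cmod p"
    if "cmod (of_real a * p + of_real b) \<le> R" for a b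
  proof -
    have "\<bar>a\<bar> * y = \<bar>Im (of_real a * p + of_real b)\<bar>" using y by (simp add: y_N_def abs_mult)
    also have "\<dots> \<le> R" using abs_Im_le_cmod that by (rule order_trans)
    finally show a: "\<bar>a\<bar> \<le> R / y" using y by (simp add: field_simps)
    have "\<bar>b\<bar> = cmod ((of_real a * p + of_real b) - of_real a * p)" by simp
    also have "\<dots> \<le> cmod (of_real a * p + of_real b) + cmod (of_real a * p)" by (rule norm_triangle_ineq4)
    also have "\<dots> \<le> R + R / y * cmod p"
      using that mult_right_mono[OF a norm_ge_zero] by (intro add_mono) (simp_all add: norm_mult)
    finally show "\<bar>b\<bar> \<le> R + R / y * cmod p" .
  qed
  have "norm A \<le> 2 * (R / y + (R + R / y * cmod p))"
    if A: "det A = 1" and Ap: "mat_action A p \<in> exhaustion n" for A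
  proof -
    define v where "v = complex_of_real (A$2$1) * p + of_real (A$2$2)"
    define u where "u = complex_of_real (A$1$1) * p + of_real (A$1$2)"
    have v: "v \<noteq> 0" unfolding v_def by (rule mat_action_denom_nonzero[OF A p])
    have "1 / N \<le> y / (cmod v)\<^sup>2" and uv: "cmod (u / v) \<le> N"
      using Ap Im_mat_action[OF A, of p]
      by (auto simp: exhaustion_def y_N_def u_def v_def mat_action_def moebius_def)
    then have "(cmod v)\<^sup>2 \<le> y * N" using v N by (simp add: field_simps)
    then have v_le: "cmod v \<le> sqrt (y * N)" by (rule real_le_rsqrt)
    also have "\<dots> \<le> R" using N y by (simp add: R_def)
    finally have vR: "cmod v \<le> R" .
    have "cmod u = cmod (u / v) * cmod v" using v by (simp add: norm_divide)
    also have "\<dots> \<le> N * sqrt (y * N)" using uv v_le N by (intro mult_mono) auto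
    finally have uR: "cmod u \<le> R" by (simp add: R_def)
    have "norm A \<le> (\<bar>A$1$1\<bar> + \<bar>A$1$2\<bar>) + (\<bar>A$2$1\<bar> + \<bar>A$2$2\<bar>)"
      using norm_matrix_le[of A] by (simp add: sum_2)
    also have "\<dots> \<le> (R / y + (R + R / y * cmod p)) + (R / y + (R + R / y * cmod p))"
      by (intro add_mono bound[OF uR[unfolded u_def]] bound[OF vR[unfolded v_def]])
    finally show ?thesis by (simp only: mult_2)
  qed
  then show ?thesis by (auto simp: bounded_iff)
qed

text \<open>Infinitely many matrix lifts in a bounded set would accumulate at some \<open>l\<close>.
  For two lifts A and B close to \<open>l\<close>, the product of the inverse of A with B is close
  to the identity and represents an element of \<open>\<Phi>\<close>, so B is A or -A. A ball about
  \<open>l\<close> would thus contain at most two of them.\<close>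

theorem fuchsian_properly_discontinuous:
  assumes \<Phi>: "fuchsian \<Phi>" and p: "p \<in> upper_half_plane"
  shows "finite {\<gamma> \<in> \<Phi>. psl_action \<gamma> p \<in> exhaustion n}"
proof -
  have sub: "subgroup \<Phi> PSL2R" using \<Phi> by (simp add: fuchsian_def)
  define T where "T = {A. det A = 1 \<and> psl A \<in> \<Phi> \<and> mat_action A p \<in> exhaustion n}"
  have "finite T"
  proof (rule ccontr)
    assume inf: "infinite T"
    have "bounded T"
      by (rule bounded_subset[OF bounded_mat_action_exhaustion[OF p, of n]]) (auto simp: T_def)
    then have "compact (closure T)" by (simp add: compact_closure)
    \<comment> \<open>The point \<open>l\<close> need not belong to \<open>T\<close>; it is used
      only through its determinant, which is one because that condition is closed.\<close>
    with inf obtain l where l: "l islimpt T"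
      unfolding compact_eq_Bolzano_Weierstrass using closure_subset by blast
    have "closed {A :: real^2^2. det A = 1}"
      unfolding det_2 by (intro closed_Collect_eq continuous_intros)
    moreover have "l islimpt {A. det A = 1}"
      by (rule islimpt_subset[OF l]) (auto simp: T_def)
    ultimately have "det l = 1" by (auto simp: closed_limpt)
    then have gl: "adjugate l ** l = mat 1" by (rule adjugate_mult)
    obtain e where e: "e > 0"
      "\<And>A. det A = 1 \<Longrightarrow> psl A \<in> \<Phi> \<Longrightarrow> dist A (mat 1) < e \<Longrightarrow> psl A = psl (mat 1)"
      using fuchsian_separated[OF \<Phi>] by blast
    obtain d where d: "d > 0"
      "\<And>A B. dist (A, B) (l, l) < d \<Longrightarrow> dist (adjugate A ** B) (mat 1) < e"
      using isCont_adjugate_mult[of "(l, l)"] e(1) unfolding continuous_at_eps_delta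
      by (auto simp: gl)
    have *: "B = A \<or> B = - A" if A: "A \<in> T \<inter> ball l (d / 2)" and B: "B \<in> T \<inter> ball l (d / 2)" for A B
    proof -
      have detAB: "det A = 1" "det B = 1" and \<Phi>AB: "psl A \<in> \<Phi>" "psl B \<in> \<Phi>"
        using A B by (auto simp: T_def)
      have "dist (A, B) (l, l) \<le> dist A l + dist B l"
        unfolding dist_Pair_Pair by (rule sqrt_sum_squares_le_sum) auto
      also have "\<dots> < d" using A B by (simp add: dist_commute)
      finally have "dist (adjugate A ** B) (mat 1) < e" by (rule d)
      moreover have "psl (adjugate A ** B) \<in> \<Phi>"
        using subgroup.m_closed[OF sub subgroup.m_inv_closed[OF sub \<Phi>AB(1)] \<Phi>AB(2)] detAB
        by (simp add: inv_psl psl_mult' det_adjugate)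
      ultimately have "psl (adjugate A ** B) = psl (mat 1)"
        using detAB by (intro e(2)) (auto simp: det_mul det_adjugate)
      then have "adjugate A ** B = mat 1 \<or> adjugate A ** B = - mat 1"
        by (simp add: psl_eq_iff)
      moreover have "A ** (adjugate A ** B) = B"
        using detAB by (simp add: matrix_mul_assoc adjugate_mult)
      ultimately show ?thesis by (auto simp: neg_matrix_mult)
    qed
    have "infinite (T \<inter> ball l (d / 2))"
      using l d(1) by (auto simp: islimpt_eq_infinite_ball)
    moreover from this obtain A where "A \<in> T \<inter> ball l (d / 2)"
      by (metis finite.emptyI ex_in_conv)
    then have "T \<inter> ball l (d / 2) \<subseteq> {A, - A}" using * by blast
    ultimately show False by (meson finite.emptyI finite.insertI finite_subset)
  qed
  moreover have "{\<gamma> \<in> \<Phi>. psl_action \<gamma> p \<in> exhaustion n} \<subseteq> psl ` T"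
  proof
    fix \<gamma> assume \<gamma>: "\<gamma> \<in> {\<gamma> \<in> \<Phi>. psl_action \<gamma> p \<in> exhaustion n}"
    then have "\<gamma> \<in> carrier PSL2R" using subgroup.subset[OF sub] by auto
    then show "\<gamma> \<in> psl ` T" using \<gamma> by (auto elim!: carrier_PSL2RE simp: T_def psl_action_psl)
  qed
  ultimately show ?thesis by (meson finite_imageI finite_subset)
qed

theorem free_fuchsian_overlap_sum:
  assumes \<Phi>: "fuchsian \<Phi>" and free: "freely_generated (PSL2R\<lparr>carrier := \<Phi>\<rparr>) S" and fin: "finite S"
    and z: "z \<in> upper_half_plane"
  shows "(\<Sum>s\<in>S. overlap z (psl_action s z)) \<le> overlap z z"
proof -
  define G where "G = PSL2R\<lparr>carrier := \<Phi>\<rparr>"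
  have sub: "subgroup \<Phi> PSL2R" using \<Phi> by (simp add: fuchsian_def)
  interpret G: group G
    unfolding G_def by (rule subgroup.subgroup_is_group[OF sub group_PSL2R])
  have free: "freely_generated G S" using free by (simp add: G_def)
  have carrier: "carrier G = \<Phi>" by (simp add: G_def)
  have \<Phi>_sub: "\<gamma> \<in> \<Phi> \<Longrightarrow> \<gamma> \<in> carrier PSL2R" for \<gamma> using subgroup.subset[OF sub] by auto
  have S: "s \<in> \<Phi>" if "s \<in> S" for s using free that by (auto simp: freely_generated_def carrier)
  have act: "psl_action \<gamma> \<in> hyp_area \<rightarrow>\<^sub>M hyp_area" if "\<gamma> \<in> carrier G" for \<gamma>
    using that mat_action_measurable \<Phi>_sub
    by (auto simp: carrier psl_action_psl[abs_def] elim!: carrier_PSL2RE[OF \<Phi>_sub])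
  have one: "psl_action \<one>\<^bsub>G\<^esub> p = p" for p by (simp add: G_def psl_action_one)
  have mult: "psl_action (\<gamma> \<otimes>\<^bsub>G\<^esub> \<delta>) p = psl_action \<gamma> (psl_action \<delta> p)"
    if "\<gamma> \<in> carrier G" "\<delta> \<in> carrier G" "p \<in> space hyp_area" for \<gamma> \<delta> p
    using that \<Phi>_sub by (simp add: G_def psl_action_mult)
  have invariant: "(\<integral>\<^sup>+p. f (psl_action \<gamma> p) \<partial>hyp_area) = (\<integral>\<^sup>+p. f p \<partial>hyp_area)"
    if "\<gamma> \<in> carrier G" "f \<in> borel_measurable hyp_area" for \<gamma> and f :: "complex \<Rightarrow> ennreal"
    using that by (auto simp: carrier psl_action_psl nn_integral_hyp_area_mat_action
        elim!: carrier_PSL2RE[OF \<Phi>_sub])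
  obtain \<phi> :: "complex \<Rightarrow> ennreal" where \<phi>: "\<phi> \<in> borel_measurable hyp_area"
    "\<And>p. p \<in> space hyp_area \<Longrightarrow> (\<integral>\<^sup>+\<gamma>. \<phi> (psl_action \<gamma> p) \<partial>count_space (carrier G)) = 1"
  proof (rule G.exists_partition_of_unity[of psl_action hyp_area exhaustion])
    show "countable (carrier G)" by (rule G.countable_freely_generated[OF free fin])
    show "finite {\<gamma> \<in> carrier G. psl_action \<gamma> p \<in> exhaustion n}" if "p \<in> space hyp_area" for p n
      using fuchsian_properly_discontinuous[OF \<Phi>, of p n] that by (simp add: carrier)
  qed (use act one mult exhaustion_sets exhaustion_covers in auto)
  define v where "v w n = ennreal (1 / real (Suc n)) *
      emeasure hyp_area (hball z (real (Suc n)) \<inter> hball w (real (Suc n)))" for w n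
  have "(\<Sum>s\<in>S. v (psl_action s z) n) \<le> v z n" for n
  proof -
    define B where "B w = hball w (real (Suc n))" for w
    have B: "B w \<in> sets hyp_area" if "w \<in> upper_half_plane" for w
      unfolding B_def using that by simp
    \<comment> \<open>This makes the minimum of the indicator and its translate the indicator of the
      intersection of the discs about \<open>z\<close> and its image.\<close>
    have Bs: "psl_action (inv\<^bsub>G\<^esub> s) p \<in> B z \<longleftrightarrow> p \<in> B (psl_action s z)"
      if s: "s \<in> S" and p: "p \<in> upper_half_plane" for s p
    proof -
      have sG: "s \<in> carrier G" using S s by (simp add: carrier)
      define q where "q = psl_action (inv\<^bsub>G\<^esub> s) p"
      have q: "q \<in> upper_half_plane"
        unfolding q_def using sG p \<Phi>_sub G.inv_closed[OF sG]
        by (intro psl_action_closed) (auto simp: carrier)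
      have "psl_action s q = p"
        unfolding q_def using mult[of s "inv\<^bsub>G\<^esub> s" p] sG p one by simp
      moreover obtain A where "s = psl A" "det A = 1"
        using sG \<Phi>_sub by (auto simp: carrier elim: carrier_PSL2RE)
      ultimately show ?thesis
        using mat_action_mem_hball_iff[of A z q "real (Suc n)"] z q
        by (simp add: B_def q_def psl_action_psl)
    qed
    have "(\<Sum>s\<in>S. emeasure hyp_area (B z \<inter> B (psl_action s z))) =
        (\<Sum>s\<in>S. \<integral>\<^sup>+p. min (indicator (B z) p) (indicator (B z) (psl_action (inv\<^bsub>G\<^esub> s) p)) \<partial>hyp_area)"
    proof (rule sum.cong)
      fix s assume s: "s \<in> S"
      have "B z \<inter> B (psl_action s z) \<in> sets hyp_area"
        using B z S[OF s] \<Phi>_sub psl_action_closed by auto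
      then have "emeasure hyp_area (B z \<inter> B (psl_action s z)) =
          (\<integral>\<^sup>+p. indicator (B z \<inter> B (psl_action s z)) p \<partial>hyp_area)" by simp
      also have "\<dots> = (\<integral>\<^sup>+p. min (indicator (B z) p) (indicator (B z) (psl_action (inv\<^bsub>G\<^esub> s) p)) \<partial>hyp_area)"
        by (rule nn_integral_cong) (use Bs[OF s] in \<open>auto simp: indicator_def\<close>)
      finally show "emeasure hyp_area (B z \<inter> B (psl_action s z)) = \<dots>" .
    qed simp
    also have "\<dots> \<le> (\<integral>\<^sup>+p. indicator (B z) p \<partial>hyp_area)"
      by (rule G.free_action_overlap_inequality[OF free fin act _ mult invariant \<phi>])
         (use one B z in auto)
    also have "\<dots> = emeasure hyp_area (B z \<inter> B z)" using B z by simp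
    finally have "ennreal (1 / real (Suc n)) * (\<Sum>s\<in>S. emeasure hyp_area (B z \<inter> B (psl_action s z))) \<le>
        ennreal (1 / real (Suc n)) * emeasure hyp_area (B z \<inter> B z)"
      by (rule mult_left_mono) simp
    then show ?thesis by (simp only: sum_distrib_left v_def B_def)
  qed
  moreover have lim: "v w \<longlonglongrightarrow> overlap z w" if "w \<in> upper_half_plane" for w
    unfolding v_def by (rule emeasure_hball_tendsto_overlap[OF z that])
  moreover have "(\<lambda>n. \<Sum>s\<in>S. v (psl_action s z) n) \<longlonglongrightarrow> (\<Sum>s\<in>S. overlap z (psl_action s z))"
    using z S \<Phi>_sub psl_action_closed by (intro tendsto_sum lim) auto
  ultimately show ?thesis
    using z by (intro LIMSEQ_le[of _ _ "v z"]) auto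
qed

text \<open>The overlap of \<open>z\<close> with itself is the total mass \<open>2 * pi\<close>;
  dividing by the factor four in \<open>overlap_eq\<close> leaves \<open>pi / 2\<close>.
  Nonnegativity of the angles allows the passage from \<open>ennreal\<close> back to real
  numbers.\<close>

lemma free_fuchsian_angle_sum:
  assumes \<Phi>: "fuchsian \<Phi>" and free: "freely_generated (PSL2R\<lparr>carrier := \<Phi>\<rparr>) S" and fin: "finite S"
    and z: "z \<in> upper_half_plane"
  shows "(\<Sum>s\<in>S. arccos (tanh (hyp_dist z (psl_action s z) / 2))) \<le> pi / 2"
proof -
  define \<theta> where "\<theta> s = arccos (tanh (hyp_dist z (psl_action s z) / 2))" for s
  have \<theta>: "\<theta> s \<ge> 0" for s
    unfolding \<theta>_def using tanh_real_bounds[of "hyp_dist z (psl_action s z) / 2"]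
    by (intro arccos_lbound) auto
  have S: "s \<in> carrier PSL2R" if "s \<in> S" for s
    using free \<Phi> that by (auto simp: freely_generated_def fuchsian_def dest: subgroup.subset)
  have "ennreal (\<Sum>s\<in>S. 4 * \<theta> s) = (\<Sum>s\<in>S. overlap z (psl_action s z))"
    using S psl_action_closed z \<theta> by (simp add: \<theta>_def overlap_eq flip: sum_ennreal)
  also have "\<dots> \<le> overlap z z" by (rule free_fuchsian_overlap_sum[OF assms])
  also have "\<dots> = ennreal (2 * pi)"
    using z by (simp add: overlap_eq) (simp add: hyp_dist_def)
  finally have "(\<Sum>s\<in>S. 4 * \<theta> s) \<le> 2 * pi"
    by (simp add: ennreal_le_iff)
  then show ?thesis by (simp add: \<theta>_def flip: sum_distrib_left)
qed

text \<open>The stated bound is the displacement L with tanh (L / 2) = cos \<alpha> for \<alpha> =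
  \<pi> / (2 k), that is, the one whose angle is \<alpha>. Smaller displacements have larger angles,
  so if all were smaller the k angles would exceed k \<alpha> = \<pi> / 2 in total.\<close>

lemma exists_large_displacement:
  fixes d :: "nat \<Rightarrow> real"
  assumes k: "k \<ge> 1" and sum: "(\<Sum>i=1..k. arccos (tanh (d i / 2))) \<le> pi / 2"
  shows "\<exists>i\<in>{1..k}. d i \<ge> ln ((1 + cos (pi / (2 * real k))) / (1 - cos (pi / (2 * real k))))"
proof (rule ccontr)
  define \<alpha> c where "\<alpha> = pi / (2 * real k)" "c = cos \<alpha>"
  have \<alpha>: "0 < \<alpha>" "\<alpha> \<le> pi / 2" using k by (auto simp: \<alpha>_c_def field_simps)
  have c: "0 \<le> c" "c < 1"
    using \<alpha> cos_monotone_0_pi[of 0 \<alpha>] cos_ge_zero[of \<alpha>] by (auto simp: \<alpha>_c_def)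
  assume "\<not> ?thesis"
  then have less: "d i < ln ((1 + c) / (1 - c))" if "i \<in> {1..k}" for i
    using that by (auto simp: \<alpha>_c_def not_le)
  have "\<alpha> < arccos (tanh (d i / 2))" if "i \<in> {1..k}" for i
  proof -
    have "tanh (d i / 2) < tanh (ln ((1 + c) / (1 - c)) / 2)"
      using less[OF that] by simp
    also have "\<dots> = c"
    proof -
      define L where "L = ln ((1 + c) / (1 - c))"
      have "exp (L / 2) * exp (L / 2) = (1 + c) / (1 - c)"
        using c by (simp add: L_def flip: exp_add)
      moreover have "(E - inverse E) / (E + inverse E) = (E * E - 1) / (E * E + 1)" if "E > 0" for E :: real
      proof -
        have "E - inverse E = (E * E - 1) / E" "E + inverse E = (E * E + 1) / E"
          using that by (simp_all add: field_simps)
        then show ?thesis using that by simp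
      qed
      from this[of "exp (L / 2)"]
      have "tanh (L / 2) = (exp (L / 2) * exp (L / 2) - 1) / (exp (L / 2) * exp (L / 2) + 1)"
        by (simp add: tanh_altdef exp_minus)
      moreover have "(1 + c) / (1 - c) - 1 = 2 * c / (1 - c)" "(1 + c) / (1 - c) + 1 = 2 / (1 - c)"
        using c by (simp_all add: field_simps)
      ultimately show ?thesis using c by (simp add: L_def)
    qed
    finally have "arccos c < arccos (tanh (d i / 2))"
      using tanh_real_bounds[of "d i / 2"] c by (intro arccos_less_arccos) auto
    then show ?thesis using \<alpha> by (simp add: \<alpha>_c_def arccos_cos)
  qed
  then have "(\<Sum>i=1..k. \<alpha>) < (\<Sum>i=1..k. arccos (tanh (d i / 2)))"
    using k by (intro sum_strict_mono) auto
  moreover have "(\<Sum>i=1..k. \<alpha>) = pi / 2" using k by (simp add: \<alpha>_c_def)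
  ultimately show False using sum by simp
qed

section \<open>The group \<open>\<Gamma>(2)\<close>\<close>

definition int_matrix :: "int \<Rightarrow> int \<Rightarrow> int \<Rightarrow> int \<Rightarrow> real^2^2" where
  "int_matrix a b c d = vector [vector [of_int a, of_int b], vector [of_int c, of_int d]]"

lemma int_matrix_nth [simp]:
  "int_matrix a b c d $ 1 $ 1 = of_int a" "int_matrix a b c d $ 1 $ 2 = of_int b"
  "int_matrix a b c d $ 2 $ 1 = of_int c" "int_matrix a b c d $ 2 $ 2 = of_int d"
  by (simp_all add: int_matrix_def)

lemma det_int_matrix: "det (int_matrix a b c d) = 1 \<longleftrightarrow> a * d - b * c = 1"
proof -
  have "det (int_matrix a b c d) = of_int (a * d - b * c)" by (simp add: det_2)
  then show ?thesis by (simp only: of_int_eq_1_iff)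
qed

lemma int_matrix_mult:
  "int_matrix a b c d ** int_matrix a' b' c' d' =
    int_matrix (a * a' + b * c') (a * b' + b * d') (c * a' + d * c') (c * b' + d * d')"
  by (simp add: matrix_eq_2_iff matrix_mult_nth)

lemma uminus_int_matrix: "- int_matrix a b c d = int_matrix (- a) (- b) (- c) (- d)"
  by (simp add: matrix_eq_2_iff)

lemma adjugate_int_matrix: "adjugate (int_matrix a b c d) = int_matrix d (- b) (- c) a"
  by (simp add: matrix_eq_2_iff)

lemma principal_congruence_2E:
  assumes "\<gamma> \<in> principal_congruence 2"
  obtains a b c d where "\<gamma> = psl (int_matrix a b c d)" "a * d - b * c = 1"
    "odd a" "even b" "even c" "odd d"
proof -
  obtain A where A: "\<gamma> = psl A" "det A = 1"
    and "\<forall>i j. \<exists>m::int. A $ i $ j = mat 1 $ i $ j + of_int (2 * m)"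
    using assms by (auto simp: principal_congruence_def SL2R_def)
  then obtain m where m: "\<And>i j. A $ i $ j = mat 1 $ i $ j + of_int (2 * m i j)" by metis
  have "A = int_matrix (1 + 2 * m 1 1) (2 * m 1 2) (2 * m 2 1) (1 + 2 * m 2 2)"
    by (simp add: matrix_eq_2_iff m)
  with A show ?thesis
    by (intro that) (auto simp flip: det_int_matrix)
qed

lemma psl_int_matrix_in_principal_congruence:
  assumes "a * d - b * c = 1" "odd a" "even b" "even c" "odd d"
  shows "psl (int_matrix a b c d) \<in> principal_congruence 2"
proof -
  obtain a' b' c' d' where "a = 2 * a' + 1" "b = 2 * b'" "c = 2 * c'" "d = 2 * d' + 1"
    using assms by (elim oddE evenE)
  then have "\<exists>m::int. int_matrix a b c d $ i $ j = mat 1 $ i $ j + of_int (2 * m)" for i j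
    using exhaust_2[of i] exhaust_2[of j]
    by (auto intro: exI[of _ a'] exI[of _ b'] exI[of _ c'] exI[of _ d'])
  then show ?thesis
    using assms(1) by (auto simp: principal_congruence_def SL2R_def det_int_matrix)
qed

lemma subgroup_principal_congruence_2: "subgroup (principal_congruence 2) PSL2R"
proof (rule group.subgroupI[OF group_PSL2R])
  show "principal_congruence 2 \<subseteq> carrier PSL2R"
    by (auto elim!: principal_congruence_2E simp: psl_closed det_int_matrix)
  show "principal_congruence 2 \<noteq> {}"
    using psl_int_matrix_in_principal_congruence[of 1 1 0 0] by auto
  fix x assume x: "x \<in> principal_congruence 2"
  then show "inv\<^bsub>PSL2R\<^esub> x \<in> principal_congruence 2"
    by (auto elim!: principal_congruence_2E simp: inv_psl det_int_matrix adjugate_int_matrix mult.commute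
        intro!: psl_int_matrix_in_principal_congruence)
  fix y assume y: "y \<in> principal_congruence 2"
  obtain a b c d where x': "x = psl (int_matrix a b c d)" "a * d - b * c = 1"
    "odd a" "even b" "even c" "odd d" by (rule principal_congruence_2E[OF x])
  obtain a' b' c' d' where y': "y = psl (int_matrix a' b' c' d')" "a' * d' - b' * c' = 1"
    "odd a'" "even b'" "even c'" "odd d'" by (rule principal_congruence_2E[OF y])
  have "(a * a' + b * c') * (c * b' + d * d') - (a * b' + b * d') * (c * a' + d * c') =
      (a * d - b * c) * (a' * d' - b' * c')" by (simp add: algebra_simps)
  then have "(a * a' + b * c') * (c * b' + d * d') - (a * b' + b * d') * (c * a' + d * c') = 1"
    by (simp only: x' y')
  then show "x \<otimes>\<^bsub>PSL2R\<^esub> y \<in> principal_congruence 2"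
    using x' y' by (auto simp: psl_mult' det_int_matrix int_matrix_mult
        intro!: psl_int_matrix_in_principal_congruence)
qed

text \<open>The set of matrices within sup-distance \<open>1/2\<close> of \<open>\<plusminus>A\<close> contains no other integer matrices.\<close>

lemma fuchsian_principal_congruence_2: "fuchsian (principal_congruence 2)"
proof -
  have "openin (subtopology PSL2R_topology (principal_congruence 2)) {\<gamma>}"
    if \<gamma>: "\<gamma> \<in> principal_congruence 2" for \<gamma>
  proof -
    obtain a b c d where abcd: "\<gamma> = psl (int_matrix a b c d)" "a * d - b * c = 1"
      by (rule principal_congruence_2E[OF \<gamma>])
    define A where "A = int_matrix a b c d"
    define N :: "real^2^2 \<Rightarrow> (real^2^2) set" where
      "N C = {B. \<forall>i j. \<bar>B $ i $ j - C $ i $ j\<bar> < 1 / 2}" for C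
    have N_minus: "B \<in> N C \<longleftrightarrow> - B \<in> N (- C)" for B C
      unfolding N_def by (auto simp: abs_minus_commute)
    define V where "V = psl ` (carrier SL2R \<inter> (N A \<union> N (- A)))"
    \<comment> \<open>Taking both signs makes the neighbourhood saturated, so it is the full
      preimage of \<open>V\<close> and its openness passes to the quotient.\<close>
    have V_vimage: "{B \<in> carrier SL2R. psl B \<in> V} = carrier SL2R \<inter> (N A \<union> N (- A))"
    proof -
      have "B \<in> N A \<union> N (- A)" if "psl B = psl C" "C \<in> N A \<union> N (- A)" for B C
        using that N_minus[of C A] N_minus[of C "- A"] by (auto simp: psl_eq_iff)
      then show ?thesis by (auto simp: V_def)
    qed
    have "open (N C)" for C
      unfolding N_def forall_2 by (intro open_Collect_conj open_Collect_less continuous_intros)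
    then have "openin PSL2R_topology V"
      unfolding PSL2R_topology_def openin_quotient_topology
      using V_vimage by (auto simp: V_def openin_open intro!: exI[of _ "N A \<union> N (- A)"])
    moreover have "V \<inter> principal_congruence 2 = {\<gamma>}"
    proof
      have "A \<in> carrier SL2R" using abcd by (simp add: A_def SL2R_def det_int_matrix)
      moreover have "A \<in> N A" by (simp add: N_def)
      ultimately show "{\<gamma>} \<subseteq> V \<inter> principal_congruence 2"
        using \<gamma> abcd(1) by (auto simp: V_def A_def)
      show "V \<inter> principal_congruence 2 \<subseteq> {\<gamma>}"
      proof
        fix \<delta> assume \<delta>: "\<delta> \<in> V \<inter> principal_congruence 2"
        then obtain a' b' c' d' where \<delta>': "\<delta> = psl (int_matrix a' b' c' d')"
            "a' * d' - b' * c' = 1"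
          by (meson IntD2 principal_congruence_2E)
        define B where "B = int_matrix a' b' c' d'"
        have "B \<in> carrier SL2R" using \<delta>' by (simp add: B_def SL2R_def det_int_matrix)
        then have "B \<in> {B \<in> carrier SL2R. psl B \<in> V}" using \<delta> \<delta>'(1) by (simp add: B_def)
        then have BN: "B \<in> N A \<union> N (- A)" unfolding V_vimage by blast
        have int: "m = n" if "\<bar>of_int m - of_int n\<bar> < (1 / 2 :: real)" for m n :: int
          using that by linarith
        have int_mat: "int_matrix p q r s = int_matrix p' q' r' s'"
          if "int_matrix p q r s \<in> N (int_matrix p' q' r' s')" for p q r s p' q' r' s'
        proof -
          have *: "\<bar>int_matrix p q r s $ i $ j - int_matrix p' q' r' s' $ i $ j\<bar> < 1 / 2" for i j
            using that by (simp add: N_def)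
          have "p = p'" by (rule int) (use *[of 1 1] in simp)
          moreover have "q = q'" by (rule int) (use *[of 1 2] in simp)
          moreover have "r = r'" by (rule int) (use *[of 2 1] in simp)
          moreover have "s = s'" by (rule int) (use *[of 2 2] in simp)
          ultimately show ?thesis by simp
        qed
        have "B = A \<or> B = - A"
          using BN int_mat unfolding A_def B_def uminus_int_matrix by blast
        then show "\<delta> \<in> {\<gamma>}" using \<delta>'(1) abcd(1) by (auto simp: A_def B_def psl_eq_iff)
      qed
    qed
    ultimately show ?thesis by (auto simp: openin_subtopology)
  qed
  moreover have "topspace PSL2R_topology = carrier PSL2R"
    by (simp add: PSL2R_topology_def topspace_quotient_topology carrier_PSL2R)
  then have "topspace (subtopology PSL2R_topology (principal_congruence 2)) = principal_congruence 2"
    using subgroup.subset[OF subgroup_principal_congruence_2] by (auto simp: topspace_subtopology)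
  ultimately show ?thesis
    unfolding fuchsian_def using subgroup_principal_congruence_2 by (metis discrete_topology_unique)
qed

abbreviation "g\<^sub>1 \<equiv> psl (int_matrix 1 2 0 1)"
abbreviation "g\<^sub>2 \<equiv> psl (int_matrix 1 0 2 1)"
abbreviation "\<Gamma>\<^sub>2 \<equiv> PSL2R\<lparr>carrier := principal_congruence 2\<rparr>"

lemma group_\<Gamma>\<^sub>2: "group \<Gamma>\<^sub>2"
  by (rule subgroup.subgroup_is_group[OF subgroup_principal_congruence_2 group_PSL2R])

lemma generators_in_\<Gamma>\<^sub>2: "g\<^sub>1 \<in> principal_congruence 2" "g\<^sub>2 \<in> principal_congruence 2"
  by (auto intro!: psl_int_matrix_in_principal_congruence)

lemma inv_\<Gamma>\<^sub>2: "x \<in> principal_congruence 2 \<Longrightarrow> inv\<^bsub>\<Gamma>\<^sub>2\<^esub> x = inv\<^bsub>PSL2R\<^esub> x"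
  by (rule group.m_inv_consistent[OF group_PSL2R subgroup_principal_congruence_2])

lemma letter_value_\<Gamma>\<^sub>2:
  "letter_value \<Gamma>\<^sub>2 (g\<^sub>1, e) = psl (int_matrix 1 (if e then 2 else - 2) 0 1)"
  "letter_value \<Gamma>\<^sub>2 (g\<^sub>2, e) = psl (int_matrix 1 0 (if e then 2 else - 2) 1)"
  by (auto simp: letter_value_def inv_\<Gamma>\<^sub>2 generators_in_\<Gamma>\<^sub>2 inv_psl det_int_matrix adjugate_int_matrix)

section \<open>Generation by row operations\<close>

definition reduced_values :: "(real^2^2) set set" where
  "reduced_values = word_value \<Gamma>\<^sub>2 ` reduced_words {g\<^sub>1, g\<^sub>2}"

text \<open>A letter either cancels against the first letter of a reduced word or can be prepended
  to it. Generation can thus be proved directly with reduced words, one letter at a time, without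
  reducing arbitrary words.\<close>

lemma (in group) letter_times_reduced_value:
  assumes S: "S \<subseteq> carrier G" and x: "fst x \<in> S" and \<gamma>: "\<gamma> \<in> word_value G ` reduced_words S"
  shows "letter_value G x \<otimes> \<gamma> \<in> word_value G ` reduced_words S"
proof -
  obtain w where w: "w \<in> reduced_words S" "\<gamma> = word_value G w" using \<gamma> by auto
  show ?thesis
  proof (cases "w \<noteq> [] \<and> hd w = opposite x")
    case True
    then obtain v where v: "w = opposite x # v" by (cases w) auto
    then have "v \<in> reduced_words S" using w by (simp add: Cons_reduced_words_iff)
    moreover have "letter_value G x \<otimes> \<gamma> = word_value G v"
      using S x w v calculation letter_value_closed[of x] word_value_closed[OF S, of v]
      by (auto simp: letter_value_opposite subset_iff simp flip: m_assoc)
    ultimately show ?thesis by auto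
  next
    case False
    then have "x # w \<in> reduced_words S" using x w by (auto simp: Cons_reduced_words_iff)
    then show ?thesis using w by (auto intro!: image_eqI[of _ _ "x # w"])
  qed
qed

text \<open>Left multiplication by a letter is a row operation adding plus or minus twice one row to
  the other; these are the moves of the Euclidean algorithm below.\<close>

lemma letter_times_reduced_values:
  assumes \<gamma>: "psl (int_matrix a b c d) \<in> reduced_values" and det: "a * d - b * c = 1"
    and s: "s = 1 \<or> s = - 1"
  shows "psl (int_matrix (a + 2 * s * c) (b + 2 * s * d) c d) \<in> reduced_values"
    and "psl (int_matrix a b (c + 2 * s * a) (d + 2 * s * b)) \<in> reduced_values"
proof -
  note step = group.letter_times_reduced_value[OF group_\<Gamma>\<^sub>2, of "{g\<^sub>1, g\<^sub>2}", folded reduced_values_def]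
  have e: "(if s = 1 then 2 else - 2) = 2 * s" using s by auto
  have *: "letter_value \<Gamma>\<^sub>2 (g, s = 1) \<otimes>\<^bsub>PSL2R\<^esub> psl (int_matrix a b c d) \<in> reduced_values"
    if "g \<in> {g\<^sub>1, g\<^sub>2}" for g
    using step[OF _ _ \<gamma>, of "(g, s = 1)"] that generators_in_\<Gamma>\<^sub>2 by auto
  show "psl (int_matrix (a + 2 * s * c) (b + 2 * s * d) c d) \<in> reduced_values"
    using *[of "g\<^sub>1"] det
    by (simp only: letter_value_\<Gamma>\<^sub>2 e) (simp add: psl_mult' det_int_matrix int_matrix_mult)
  show "psl (int_matrix a b (c + 2 * s * a) (d + 2 * s * b)) \<in> reduced_values"
    using *[of "g\<^sub>2"] det
    by (simp only: letter_value_\<Gamma>\<^sub>2 e) (simp add: psl_mult' det_int_matrix int_matrix_mult add.commute)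
qed

lemma upper_triangular_in_reduced_values:
  "psl (int_matrix 1 (2 * n) 0 1) \<in> reduced_values"
proof (induction n rule: int_induct[where k = 0])
  case base
  have "int_matrix 1 (2 * 0) 0 1 = mat 1" by (simp add: matrix_eq_2_iff)
  then show ?case
    by (auto simp: reduced_values_def one_PSL2R intro!: image_eqI[of _ _ "[]"])
next
  case (step1 n)
  then show ?case using letter_times_reduced_values(1)[of 1 "2 * n" 0 1 1] by (simp add: algebra_simps)
next
  case (step2 n)
  then show ?case using letter_times_reduced_values(1)[of 1 "2 * n" 0 1 "- 1"] by (simp add: algebra_simps)
qed

text \<open>Euclidean algorithm on the first column \<open>(a, c)\<close>, whose entries have different parity.\<close>

lemma int_matrix_in_reduced_values:
  assumes "a * d - b * c = 1" "odd a" "even b" "even c" "odd d"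
  shows "psl (int_matrix a b c d) \<in> reduced_values"
  using assms
proof (induction "nat \<bar>a\<bar> + nat \<bar>c\<bar>" arbitrary: a b c d rule: less_induct)
  case less
  show ?case
  proof (cases "c = 0")
    case True
    with less.prems(1) have "a = 1 \<and> d = 1 \<or> a = - 1 \<and> d = - 1"
      by (auto simp: zmult_eq_1_iff)
    moreover obtain n where n: "b = 2 * n" using less.prems by (elim evenE)
    \<comment> \<open>The diagonal -1 is absorbed by the sign ambiguity in
      \<open>PSL2R\<close>.\<close>
    moreover have "psl (int_matrix (- 1) (2 * n) 0 (- 1)) = psl (int_matrix 1 (2 * - n) 0 1)"
      by (auto simp: psl_eq_iff uminus_int_matrix)
    ultimately show ?thesis
      using True upper_triangular_in_reduced_values[of n] upper_triangular_in_reduced_values[of "- n"]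
      by auto
  next
    case False
    \<comment> \<open>The sign is that of the product of \<open>a\<close> and \<open>c\<close>, so
      subtracting twice the smaller entry in absolute value pulls the larger one towards zero. It
      may overshoot, but by less than its original absolute value.\<close>
    define s :: int where "s = (if 0 < a \<longleftrightarrow> 0 < c then 1 else - 1)"
    have s: "s = 1 \<or> s = - 1" "- s = 1 \<or> - s = - 1" by (auto simp: s_def)
    \<comment> \<open>Parity: \<open>a\<close> is odd and \<open>c\<close> is even.\<close>
    have ne: "\<bar>a\<bar> \<noteq> \<bar>c\<bar>" "a \<noteq> 0" using less.prems by (auto simp: abs_if split: if_splits)
    then consider "\<bar>c\<bar> < \<bar>a\<bar>" | "\<bar>a\<bar> < \<bar>c\<bar>" by linarith
    then show ?thesis
    proof cases
      case 1
      have "\<bar>a - 2 * s * c\<bar> < \<bar>a\<bar>"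
        using 1 False by (auto simp: s_def split: if_splits)
      then have "psl (int_matrix (a - 2 * s * c) (b - 2 * s * d) c d) \<in> reduced_values"
        using less.prems by (intro less.hyps) (auto simp: algebra_simps)
      from letter_times_reduced_values(1)[OF this _ s(1)] less.prems(1) show ?thesis
        by (simp add: algebra_simps)
    next
      case 2
      have "\<bar>c - 2 * s * a\<bar> < \<bar>c\<bar>"
        using 2 ne by (auto simp: s_def split: if_splits)
      then have "psl (int_matrix a b (c - 2 * s * a) (d - 2 * s * b)) \<in> reduced_values"
        using less.prems by (intro less.hyps) (auto simp: algebra_simps)
      from letter_times_reduced_values(2)[OF this _ s(1)] less.prems(1) show ?thesis
        by (simp add: algebra_simps)
    qed
  qed
qed

section \<open>Freeness by ping-pong\<close>

lemma g\<^sub>1_neq_g\<^sub>2: "g\<^sub>1 \<noteq> g\<^sub>2"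
  by (auto simp: psl_eq_iff matrix_eq_2_iff)

text \<open>The ping-pong regions are the four half-planes bounding a fundamental domain; including the
  boundary in exactly one region of each opposite pair makes the ping-pong maps exact.\<close>

definition region :: "(real^2^2) set \<times> bool \<Rightarrow> complex \<Rightarrow> bool" where
  "region x p \<longleftrightarrow>
    (if fst x = g\<^sub>1 then if snd x then 1 \<le> Re p else Re p < - 1
     else if snd x then (cmod p)\<^sup>2 \<le> Re p else (cmod p)\<^sup>2 < - Re p)"

text \<open>The regions of the second generator are half-discs over the diameters [0, 1] and
  [-1, 0]. They touch each other and the lines Re p = 1 and Re p = -1 only on the real axis, outside
  the half-plane; algebraically this is \<open>Re p * Re p < (cmod p)\<^sup>2\<close>.\<close>

lemma region_disjoint:
  assumes "fst x \<in> {g\<^sub>1, g\<^sub>2}" "fst y \<in> {g\<^sub>1, g\<^sub>2}" "p \<in> upper_half_plane" "region x p" "region y p"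
  shows "x = y"
proof -
  define c where "c = (cmod p)\<^sup>2"
  have c: "Re p * Re p < c" "0 < c"
    using assms(3) unfolding cmod_power2 c_def
    by (auto simp: power2_eq_square upper_half_plane_def intro!: add_nonneg_pos)
  have "\<not> (1 \<le> Re p \<and> c \<le> Re p)"
  proof
    assume "1 \<le> Re p \<and> c \<le> Re p"
    moreover from this have "1 * Re p \<le> Re p * Re p" by (intro mult_right_mono) auto
    ultimately show False using c by linarith
  qed
  moreover have "\<not> (Re p < - 1 \<and> c < - Re p)"
  proof
    assume "Re p < - 1 \<and> c < - Re p"
    moreover from this have "1 * (- Re p) \<le> (- Re p) * (- Re p)" by (intro mult_right_mono) auto
    ultimately show False using c by simp
  qed
  moreover have "fst x = fst y \<or> {fst x, fst y} = {g\<^sub>1, g\<^sub>2}" using assms(1,2) by blast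
  ultimately have "fst x = fst y \<and> snd x = snd y"
    using assms(4,5) g\<^sub>1_neq_g\<^sub>2 c unfolding region_def c_def[symmetric] doubleton_eq_iff
    by (smt (verit))
  then show ?thesis by (simp add: prod_eq_iff)
qed

text \<open>The first generator translates p by 2. The second translates 1 / p by 2, and its regions
  are the conditions Re (1 / p) \<ge> 1 and Re (1 / p) < -1, so both generators follow the same
  pattern. In the computation this shows as a common denominator of the squared modulus and the real
  part of the image.\<close>

lemma region_letter:
  assumes x: "fst x \<in> {g\<^sub>1, g\<^sub>2}" and p: "p \<in> upper_half_plane" and "\<not> region (opposite x) p"
  shows "region x (psl_action (letter_value \<Gamma>\<^sub>2 x) p)"
proof -
  have m: "(cmod (p / (of_real r * p + 1)))\<^sup>2 = (cmod p)\<^sup>2 / (cmod (of_real r * p + 1))\<^sup>2"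
    "Re (p / (of_real r * p + 1)) = (r * (cmod p)\<^sup>2 + Re p) / (cmod (of_real r * p + 1))\<^sup>2" for r :: real
  proof -
    show "(cmod (p / (of_real r * p + 1)))\<^sup>2 = (cmod p)\<^sup>2 / (cmod (of_real r * p + 1))\<^sup>2"
      by (simp add: norm_divide power_divide)
    have "Re (p / (of_real r * p + 1)) =
        (Re p * (r * Re p + 1) + Im p * (r * Im p)) / (cmod (of_real r * p + 1))\<^sup>2"
      by (simp add: Re_divide cmod_power2)
    also have "Re p * (r * Re p + 1) + Im p * (r * Im p) = r * (cmod p)\<^sup>2 + Re p"
      unfolding cmod_power2 by (simp add: power2_eq_square algebra_simps)
    finally show "Re (p / (of_real r * p + 1)) = (r * (cmod p)\<^sup>2 + Re p) / (cmod (of_real r * p + 1))\<^sup>2" .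
  qed
  have D: "(cmod (of_real r * p + 1))\<^sup>2 > 0" for r :: real
  proof -
    have "of_real r * p + 1 \<noteq> 0"
      using p by (auto simp: complex_eq_iff upper_half_plane_def)
    then show ?thesis by simp
  qed
  obtain g e where ge: "x = (g, e)" "g = g\<^sub>1 \<or> g = g\<^sub>2" using x by (cases x) auto
  from ge(2) show ?thesis
  proof
    assume "g = g\<^sub>1"
    with assms(3) show ?thesis
      by (auto simp: ge region_def opposite_def letter_value_\<Gamma>\<^sub>2 psl_action_psl mat_action_def moebius_def)
  next
    assume g: "g = g\<^sub>2"
    define r :: real where "r = (if e then 2 else - 2)"
    have act: "psl_action (letter_value \<Gamma>\<^sub>2 x) p = p / (of_real r * p + 1)"
      by (simp add: ge g letter_value_\<Gamma>\<^sub>2 psl_action_psl mat_action_def moebius_def r_def)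
    define q where "q = p / (of_real r * p + 1)"
    have "(cmod q)\<^sup>2 \<le> Re q \<longleftrightarrow> (cmod p)\<^sup>2 \<le> r * (cmod p)\<^sup>2 + Re p"
      unfolding q_def m by (rule divide_le_cancel[THEN trans]) (use D[of r] in auto)
    moreover have "(cmod q)\<^sup>2 < - Re q \<longleftrightarrow> (cmod p)\<^sup>2 < - (r * (cmod p)\<^sup>2 + Re p)"
      unfolding q_def m minus_divide_left
      by (rule divide_less_cancel[THEN trans]) (use D[of r] in auto)
    ultimately have "region x q \<longleftrightarrow> (if e then (cmod p)\<^sup>2 \<le> r * (cmod p)\<^sup>2 + Re p
        else (cmod p)\<^sup>2 < - (r * (cmod p)\<^sup>2 + Re p))"
      using g\<^sub>1_neq_g\<^sub>2[symmetric] by (simp add: region_def ge g)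
    moreover have "\<not> (if e then (cmod p)\<^sup>2 < - Re p else (cmod p)\<^sup>2 \<le> Re p)"
      using assms(3) g\<^sub>1_neq_g\<^sub>2[symmetric] by (cases e) (simp_all add: region_def ge g opposite_def)
    ultimately have "region x q" by (simp add: r_def split: if_splits)
    then show ?thesis
      by (simp add: act q_def)
  qed
qed

lemma not_region_i: "\<not> region x \<i>"
  by (simp add: region_def)

text \<open>Ping-pong: the first letter of a reduced word can be read off from the region that the
  image of \<open>\<i>\<close> enters. The induction starts because \<open>\<i>\<close> lies outside
  all four regions, and continues because the next letter is never opposite to the current
  one.\<close>

lemma region_word_value:
  assumes "w \<in> reduced_words {g\<^sub>1, g\<^sub>2}"
  shows "psl_action (word_value \<Gamma>\<^sub>2 w) \<i> \<in> upper_half_plane \<and>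
    (w \<noteq> [] \<longrightarrow> region (hd w) (psl_action (word_value \<Gamma>\<^sub>2 w) \<i>))"
  using assms
proof (induction w)
  case Nil
  then show ?case using psl_action_one[of \<i>] by (simp add: upper_half_plane_def)
next
  case (Cons x w)
  interpret group \<Gamma>\<^sub>2 by (rule group_\<Gamma>\<^sub>2)
  have S: "{g\<^sub>1, g\<^sub>2} \<subseteq> carrier \<Gamma>\<^sub>2" using generators_in_\<Gamma>\<^sub>2 by auto
  have x: "fst x \<in> {g\<^sub>1, g\<^sub>2}" and w: "w \<in> reduced_words {g\<^sub>1, g\<^sub>2}" "w \<noteq> [] \<longrightarrow> hd w \<noteq> opposite x"
    using Cons.prems by (auto simp: Cons_reduced_words_iff)
  define q where "q = psl_action (word_value \<Gamma>\<^sub>2 w) \<i>"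
  have q: "q \<in> upper_half_plane" using Cons.IH[OF w(1)] by (simp add: q_def)
  have in_PSL: "\<gamma> \<in> carrier \<Gamma>\<^sub>2 \<Longrightarrow> \<gamma> \<in> carrier PSL2R" for \<gamma>
    using subgroup.subset[OF subgroup_principal_congruence_2] by auto
  have closed: "letter_value \<Gamma>\<^sub>2 x \<in> carrier PSL2R" "word_value \<Gamma>\<^sub>2 w \<in> carrier PSL2R"
    by (intro in_PSL letter_value_closed[OF subsetD[OF S x]] word_value_closed[OF S w(1)])+
  have "\<i> \<in> upper_half_plane" by (simp add: upper_half_plane_def)
  from psl_action_mult[OF closed this]
  have act: "psl_action (word_value \<Gamma>\<^sub>2 (x # w)) \<i> = psl_action (letter_value \<Gamma>\<^sub>2 x) q"
    unfolding q_def word_value_Cons by simp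
  have "\<not> region (opposite x) q"
  proof (cases "w = []")
    case True
    then have "q = \<i>" using psl_action_one[of \<i>] by (simp add: q_def)
    then show ?thesis by (simp only: not_region_i not_False_eq_True)
  next
    case False
    have "fst (hd w) \<in> {g\<^sub>1, g\<^sub>2}" using w(1) False by (cases w) (auto simp: Cons_reduced_words_iff)
    moreover have "fst (opposite x) \<in> {g\<^sub>1, g\<^sub>2}" using x by (simp add: opposite_def)
    moreover have "region (hd w) q" using Cons.IH[OF w(1)] False by (simp add: q_def)
    ultimately have "region (opposite x) q \<Longrightarrow> hd w = opposite x"
      using region_disjoint[OF _ _ q] by simp
    then show ?thesis using w(2) False by blast
  qed
  then show ?case
    using region_letter[OF x q] psl_action_closed[OF closed(1) q] unfolding act by simp
qed

lemma word_value_neq_one: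
  assumes "w \<in> reduced_words {g\<^sub>1, g\<^sub>2}" "w \<noteq> []"
  shows "word_value \<Gamma>\<^sub>2 w \<noteq> \<one>\<^bsub>\<Gamma>\<^sub>2\<^esub>"
proof
  assume "word_value \<Gamma>\<^sub>2 w = \<one>\<^bsub>\<Gamma>\<^sub>2\<^esub>"
  then have "psl_action (word_value \<Gamma>\<^sub>2 w) \<i> = \<i>" using psl_action_one[of \<i>] by simp
  then have "region (hd w) \<i>" using region_word_value[OF assms(1)] assms(2) by simp
  then show False by (simp only: not_region_i)
qed

text \<open>Equal values move \<open>\<i>\<close> to the same point, and disjointness of the regions
  forces equal first letters, which are then cancelled.\<close>

lemma word_value_eq_imp_eq:
  assumes "v \<in> reduced_words {g\<^sub>1, g\<^sub>2}" "w \<in> reduced_words {g\<^sub>1, g\<^sub>2}"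
    "word_value \<Gamma>\<^sub>2 v = word_value \<Gamma>\<^sub>2 w"
  shows "v = w"
  using assms
proof (induction v arbitrary: w)
  case Nil
  then have "word_value \<Gamma>\<^sub>2 w = \<one>\<^bsub>\<Gamma>\<^sub>2\<^esub>" by (simp only: word_value_Nil)
  then show ?case using word_value_neq_one[OF Nil.prems(2)] by blast
next
  case (Cons x v)
  interpret group \<Gamma>\<^sub>2 by (rule group_\<Gamma>\<^sub>2)
  have S: "{g\<^sub>1, g\<^sub>2} \<subseteq> carrier \<Gamma>\<^sub>2" using generators_in_\<Gamma>\<^sub>2 by auto
  note r = region_word_value[OF Cons.prems(1)]
  have "w \<noteq> []"
  proof
    assume "w = []"
    then have "word_value \<Gamma>\<^sub>2 (x # v) = \<one>\<^bsub>\<Gamma>\<^sub>2\<^esub>" using Cons.prems(3) by (simp only: word_value_Nil)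
    then show False using word_value_neq_one[OF Cons.prems(1)] by blast
  qed
  then obtain y w' where w: "w = y # w'" by (cases w) auto
  have xy: "fst x \<in> {g\<^sub>1, g\<^sub>2}" "fst y \<in> {g\<^sub>1, g\<^sub>2}" and vw: "v \<in> reduced_words {g\<^sub>1, g\<^sub>2}" "w' \<in> reduced_words {g\<^sub>1, g\<^sub>2}"
    using Cons.prems(1,2) by (auto simp: Cons_reduced_words_iff w)
  have "region (hd w) (psl_action (word_value \<Gamma>\<^sub>2 (x # v)) \<i>)"
    using region_word_value[OF Cons.prems(2)] \<open>w \<noteq> []\<close> unfolding Cons.prems(3) by blast
  then have x: "x = y"
    using region_disjoint[OF xy] r unfolding w list.sel by blast
  have eq: "letter_value \<Gamma>\<^sub>2 x \<otimes>\<^bsub>\<Gamma>\<^sub>2\<^esub> word_value \<Gamma>\<^sub>2 v = letter_value \<Gamma>\<^sub>2 x \<otimes>\<^bsub>\<Gamma>\<^sub>2\<^esub> word_value \<Gamma>\<^sub>2 w'"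
    using Cons.prems(3) unfolding w x word_value_Cons .
  have "letter_value \<Gamma>\<^sub>2 x \<in> Units \<Gamma>\<^sub>2"
    unfolding Units_eq using xy(1) S by (intro letter_value_closed) blast
  from Units_l_cancel[OF this word_value_closed[OF S vw(1)] word_value_closed[OF S vw(2)]] eq
  have "word_value \<Gamma>\<^sub>2 v = word_value \<Gamma>\<^sub>2 w'" by (rule iffD1)
  then show ?case using Cons.IH[OF vw] x by (simp add: w)
qed

lemma reduced_values_eq: "reduced_values = principal_congruence 2"
proof
  have "{g\<^sub>1, g\<^sub>2} \<subseteq> carrier \<Gamma>\<^sub>2" using generators_in_\<Gamma>\<^sub>2 by auto
  from group.word_value_closed[OF group_\<Gamma>\<^sub>2 this] show "reduced_values \<subseteq> principal_congruence 2"
    by (auto simp: reduced_values_def)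
  show "principal_congruence 2 \<subseteq> reduced_values"
    by (auto elim!: principal_congruence_2E intro: int_matrix_in_reduced_values)
qed

theorem freely_generated_principal_congruence_2: "freely_generated \<Gamma>\<^sub>2 {g\<^sub>1, g\<^sub>2}"
  unfolding freely_generated_def bij_betw_def
proof (intro conjI)
  show "{g\<^sub>1, g\<^sub>2} \<subseteq> carrier \<Gamma>\<^sub>2" using generators_in_\<Gamma>\<^sub>2 by auto
  show "inj_on (word_value \<Gamma>\<^sub>2) (reduced_words {g\<^sub>1, g\<^sub>2})"
    by (rule inj_onI) (rule word_value_eq_imp_eq)
  show "word_value \<Gamma>\<^sub>2 ` reduced_words {g\<^sub>1, g\<^sub>2} = carrier \<Gamma>\<^sub>2"
    using reduced_values_eq by (simp add: reduced_values_def)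
qed

theorem generate_principal_congruence_2: "principal_congruence 2 = generate PSL2R {g\<^sub>1, g\<^sub>2}"
proof
  have "{g\<^sub>1, g\<^sub>2} \<subseteq> principal_congruence 2" using generators_in_\<Gamma>\<^sub>2 by simp
  then show "generate PSL2R {g\<^sub>1, g\<^sub>2} \<subseteq> principal_congruence 2"
    by (rule group.generate_subgroup_incl[OF group_PSL2R _ subgroup_principal_congruence_2])
  have "word_value \<Gamma>\<^sub>2 w \<in> generate PSL2R {g\<^sub>1, g\<^sub>2}" if "w \<in> reduced_words {g\<^sub>1, g\<^sub>2}" for w
    using that
  proof (induction w)
    case Nil
    show ?case using generate.one[of PSL2R] by simp
  next
    case (Cons x w)
    then have x: "fst x \<in> {g\<^sub>1, g\<^sub>2}" and w: "word_value \<Gamma>\<^sub>2 w \<in> generate PSL2R {g\<^sub>1, g\<^sub>2}"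
      by (simp_all add: Cons_reduced_words_iff)
    have "fst x \<in> principal_congruence 2"
      using x \<open>{g\<^sub>1, g\<^sub>2} \<subseteq> principal_congruence 2\<close> by (rule subsetD[rotated])
    from inv_\<Gamma>\<^sub>2[OF this] have "letter_value \<Gamma>\<^sub>2 x \<in> generate PSL2R {g\<^sub>1, g\<^sub>2}"
      using generate.incl[OF x] generate.inv[OF x] by (cases "snd x") (simp_all add: letter_value_def)
    from generate.eng[OF this w] show ?case by simp
  qed
  then have "reduced_values \<subseteq> generate PSL2R {g\<^sub>1, g\<^sub>2}"
    unfolding reduced_values_def by (rule image_subsetI)
  then show "principal_congruence 2 \<subseteq> generate PSL2R {g\<^sub>1, g\<^sub>2}"
    by (simp only: reduced_values_eq)
qed

text \<open>If cosh (2 d) = 3 then sinh d = 1, so the angle is \<pi> / 2 - arctan 1. Both generators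
  displace \<open>\<i>\<close> by \<open>arcosh 3\<close>, and two such angles give exactly \<pi> /
  2.\<close>

lemma arccos_tanh_half_arcosh_3: "arccos (tanh (arcosh 3 / 2)) = pi / (4 :: real)"
proof -
  define d :: real where "d = arcosh 3 / 2"
  have "cosh (2 * d) = 3" by (simp add: d_def)
  then have sq: "(sinh d)\<^sup>2 = 1\<^sup>2" by (simp add: cosh_double_cosh cosh_square_eq)
  have "0 \<le> sinh d" by (simp add: d_def)
  from power2_eq_imp_eq[OF sq this zero_le_one] have "sinh d = 1" .
  then show ?thesis by (simp add: arccos_tanh arctan_one flip: d_def)
qed

lemma hyp_dist_generators:
  "hyp_dist \<i> (psl_action g\<^sub>1 \<i>) = arcosh 3" "hyp_dist \<i> (psl_action g\<^sub>2 \<i>) = arcosh 3"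
proof -
  have "psl_action g\<^sub>1 \<i> = mat_action (int_matrix 1 2 0 1) \<i>" by (rule psl_action_psl)
  also have "\<dots> = Complex 2 1"
    by (simp add: mat_action_def moebius_def complex_eq_iff)
  finally show "hyp_dist \<i> (psl_action g\<^sub>1 \<i>) = arcosh 3"
    by (simp only: hyp_dist_def) (simp add: cmod_power2)
  have "psl_action g\<^sub>2 \<i> = mat_action (int_matrix 1 0 2 1) \<i>" by (rule psl_action_psl)
  also have "\<dots> = Complex (2 / 5) (1 / 5)"
    by (simp add: mat_action_def moebius_def complex_eq_iff Re_divide Im_divide)
  finally show "hyp_dist \<i> (psl_action g\<^sub>2 \<i>) = arcosh 3"
    by (simp only: hyp_dist_def) (simp add: cmod_power2 power_divide)
qed

theorem mainTheorem1:
  shows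
    "(\<forall>(k::nat) (\<Phi> :: (real^2^2) set set) (g :: nat \<Rightarrow> (real^2^2) set) (z::complex).
        k \<ge> 2 \<and> fuchsian \<Phi> \<and> inj_on g {1..k} \<and>
        freely_generated (PSL2R\<lparr>carrier := \<Phi>\<rparr>) (g ` {1..k}) \<and>
        z \<in> upper_half_plane \<longrightarrow>
          (\<Sum>i=1..k. arccos (tanh (hyp_dist z (psl_action (g i) z) / 2))) \<le> pi / 2 \<and>
          (\<exists>i\<in>{1..k}. hyp_dist z (psl_action (g i) z) \<ge>
             ln ((1 + cos (pi / (2 * real k))) / (1 - cos (pi / (2 * real k))))))
     \<and>
     (let g1 = psl (vector [vector [1, 2], vector [0, 1]]);
          g2 = psl (vector [vector [1, 0], vector [2, 1]])
      in principal_congruence 2 = generate PSL2R {g1, g2} \<and>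
         fuchsian (principal_congruence 2) \<and>
         g1 \<noteq> g2 \<and>
         freely_generated (PSL2R\<lparr>carrier := principal_congruence 2\<rparr>) {g1, g2} \<and>
         arccos (tanh (hyp_dist \<i> (psl_action g1 \<i>) / 2)) +
         arccos (tanh (hyp_dist \<i> (psl_action g2 \<i>) / 2)) = pi / 2)"
proof (rule conjI)
  show "\<forall>(k::nat) (\<Phi> :: (real^2^2) set set) (g :: nat \<Rightarrow> (real^2^2) set) (z::complex).
        k \<ge> 2 \<and> fuchsian \<Phi> \<and> inj_on g {1..k} \<and>
        freely_generated (PSL2R\<lparr>carrier := \<Phi>\<rparr>) (g ` {1..k}) \<and>
        z \<in> upper_half_plane \<longrightarrow>
          (\<Sum>i=1..k. arccos (tanh (hyp_dist z (psl_action (g i) z) / 2))) \<le> pi / 2 \<and>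
          (\<exists>i\<in>{1..k}. hyp_dist z (psl_action (g i) z) \<ge>
             ln ((1 + cos (pi / (2 * real k))) / (1 - cos (pi / (2 * real k)))))"
  proof (intro allI impI, elim conjE)
    fix k :: nat and \<Phi> :: "(real^2^2) set set" and g :: "nat \<Rightarrow> (real^2^2) set" and z :: complex
    assume k: "k \<ge> 2" and \<Phi>: "fuchsian \<Phi>" "freely_generated (PSL2R\<lparr>carrier := \<Phi>\<rparr>) (g ` {1..k})"
      and inj: "inj_on g {1..k}" and z: "z \<in> upper_half_plane"
    \<comment> \<open>Injectivity of \<open>g\<close> ensures that no two terms of the sum merge
      when it is taken over the generating set.\<close>
    have "(\<Sum>i=1..k. arccos (tanh (hyp_dist z (psl_action (g i) z) / 2))) =
        (\<Sum>s\<in>g ` {1..k}. arccos (tanh (hyp_dist z (psl_action s z) / 2)))"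
      by (simp only: sum.reindex[OF inj] o_def)
    also have "\<dots> \<le> pi / 2"
      by (rule free_fuchsian_angle_sum[OF \<Phi> _ z]) simp
    finally have sum: "(\<Sum>i=1..k. arccos (tanh (hyp_dist z (psl_action (g i) z) / 2))) \<le> pi / 2" .
    have "1 \<le> k" using k by simp
    with sum show "(\<Sum>i=1..k. arccos (tanh (hyp_dist z (psl_action (g i) z) / 2))) \<le> pi / 2 \<and>
          (\<exists>i\<in>{1..k}. hyp_dist z (psl_action (g i) z) \<ge>
             ln ((1 + cos (pi / (2 * real k))) / (1 - cos (pi / (2 * real k)))))"
      by (intro conjI exists_large_displacement)
  qed
  have matrices: "vector [vector [1, 2], vector [0, 1]] = int_matrix 1 2 0 1"
    "vector [vector [1, 0], vector [2, 1]] = int_matrix 1 0 2 1"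
    by (simp_all add: int_matrix_def)
  show "let g1 = psl (vector [vector [1, 2], vector [0, 1]]);
          g2 = psl (vector [vector [1, 0], vector [2, 1]])
      in principal_congruence 2 = generate PSL2R {g1, g2} \<and>
         fuchsian (principal_congruence 2) \<and>
         g1 \<noteq> g2 \<and>
         freely_generated (PSL2R\<lparr>carrier := principal_congruence 2\<rparr>) {g1, g2} \<and>
         arccos (tanh (hyp_dist \<i> (psl_action g1 \<i>) / 2)) +
         arccos (tanh (hyp_dist \<i> (psl_action g2 \<i>) / 2)) = pi / 2"
    unfolding Let_def matrices hyp_dist_generators arccos_tanh_half_arcosh_3
    by (intro conjI generate_principal_congruence_2 fuchsian_principal_congruence_2 g\<^sub>1_neq_g\<^sub>2
        freely_generated_principal_congruence_2) simp
qed

end
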